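(* Let $(M,g)$ be a semi-Riemannian manifold and $\gamma:[a,b]\to M$ a nonconstant geodesic. Let $L\subset T_{\gamma(a)}M\oplus T_{\gamma(a)}M$ be a Lagrangian subspace, and assume that $P=\pi_1(L)$ is orthogonal to $\dot\gamma(a)$ and that the restriction of $g$ to $P$ is nondegenerate, where $\pi_1:T_{\gamma(a)}M\oplus T_{\gamma(a)}M\to T_{\gamma(a)}M$ is the projection onto the first summand. Then there exists a smooth submanifold $\mathcal P\subset M$ with $\gamma(a)\in\mathcal P$, orthogonal to $\dot\gamma(a)$ at $\gamma(a)$, such that $L=L_{\mathcal P}$.
   Context: $T_{\gamma(a)}M\oplus T_{\gamma(a)}M$ carries the symplectic form $\omega\big((v_1,w_1),(v_2,w_2)\big)=g(v_2,w_1)-g(v_1,w_2)$; orthogonality ($\perp$) is with respect to $g$. For a smooth submanifold $\mathcal P\ni\gamma(a)$ with $\dot\gamma(a)\in T_{\gamma(a)}\mathcal P^\perp$ and $g|_{T_{\gamma(a)}\mathcal P}$ nondegenerate, let $S:T_{\gamma(a)}\mathcal P\to T_{\gamma(a)}\mathcal P$ be the $g$-symmetric operator representing the second fundamental form of $\mathcal P$ at $\gamma(a)$ in the normal direction $\dot\gamma(a)$, i.e. $g(S(v),v')=g(\nabla_vV',\dot\gamma(a))$ for any local extension $V'$ of $v'$ to a field tangent to $\mathcal P$. Then $L_{\mathcal P}$ is the Lagrangian subspace $$L_{\mathcal P}=\{(v,w)\in T_{\gamma(a)}M\oplus T_{\gamma(a)}M: v\in T_{\gamma(a)}\mathcal P,\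 w+S(v)\in T_{\gamma(a)}\mathcal P^\perp\}.$$ *)

theory Defs
  imports "HOL-Analysis.Analysis"
begin

text \<open>Only meaningful on open sets, the derivatives being full ones.\<close>

fun ck_on :: "nat \<Rightarrow> ('a::real_normed_vector \<Rightarrow> 'b::real_normed_vector) \<Rightarrow> 'a set \<Rightarrow> bool" where
  "ck_on 0 f S \<longleftrightarrow> continuous_on S f"
| "ck_on (Suc k) f S \<longleftrightarrow> (\<forall>x\<in>S. f differentiable (at x)) \<and>
     (\<forall>v. ck_on k (\<lambda>x. frechet_derivative f (at x) v) S)"

definition smooth_on :: "('a::real_normed_vector \<Rightarrow> 'b::real_normed_vector) \<Rightarrow> 'a set \<Rightarrow> bool" where
  "smooth_on f S \<longleftrightarrow> (\<forall>k. ck_on k f S)"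

text \<open>A chart is a pair \<open>(U, \<phi>)\<close>; the values of \<open>\<phi>\<close> outside \<open>U\<close> are irrelevant.\<close>

type_synonym ('m, 'e) chart = "'m set \<times> ('m \<Rightarrow> 'e)"

definition chart_inv :: "('m, 'e) chart \<Rightarrow> 'e \<Rightarrow> 'm" where
  "chart_inv c = inv_into (fst c) (snd c)"

definition is_chart :: "('m::topological_space, 'e::euclidean_space) chart \<Rightarrow> bool" where
  "is_chart c \<longleftrightarrow> open (fst c) \<and> open (snd c ` fst c) \<and>
     homeomorphism (fst c) (snd c ` fst c) (snd c) (chart_inv c)"

definition smooth_compatible ::
    "('m, 'e::euclidean_space) chart \<Rightarrow> ('m, 'e) chart \<Rightarrow> bool" where
  "smooth_compatible c d \<longleftrightarrow>
     smooth_on (snd d \<circ> chart_inv c) (snd c ` (fst c \<inter> fst d)) \<and>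
     smooth_on (snd c \<circ> chart_inv d) (snd d ` (fst c \<inter> fst d))"

text \<open>A smooth structure is a maximal smooth atlas. The manifold is the whole type \<open>'m\<close>
  (Hausdorff and second countable by its type classes), of dimension \<open>DIM('e)\<close>.\<close>

definition smooth_structure ::
    "('m::{t2_space, second_countable_topology}, 'e::euclidean_space) chart set \<Rightarrow> bool" where
  "smooth_structure A \<longleftrightarrow>
     (\<forall>c\<in>A. is_chart c) \<and> (\<Union>c\<in>A. fst c) = UNIV \<and>
     (\<forall>c\<in>A. \<forall>d\<in>A. smooth_compatible c d) \<and>
     (\<forall>c. is_chart c \<and> (\<forall>d\<in>A. smooth_compatible c d) \<longrightarrow> c \<in> A)"

text \<open>For each point \<open>p\<close> a chart of the atlas around \<open>p\<close> is chosen, and the tangent space at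
  \<open>p\<close> is modelled by \<open>'e\<close>: the element \<open>v :: 'e\<close> stands for the tangent vector at \<open>p\<close> whose
  coordinates in the chart \<open>chart_at A p\<close> are \<open>v\<close>. Coordinates in the other charts are
  obtained through the differential of the change of charts. Thus the meaning of
  \<open>v :: 'e\<close> as a tangent vector depends on the base point.\<close>

definition chart_at :: "('m, 'e) chart set \<Rightarrow> 'm \<Rightarrow> ('m, 'e) chart" where
  "chart_at A p = (SOME c. c \<in> A \<and> p \<in> fst c)"

definition to_coord ::
    "('m, 'e::euclidean_space) chart set \<Rightarrow> ('m, 'e) chart \<Rightarrow> 'm \<Rightarrow> 'e \<Rightarrow> 'e" where
  "to_coord A c p =
     frechet_derivative (snd c \<circ> chart_inv (chart_at A p)) (at (snd (chart_at A p) p))"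

definition from_coord ::
    "('m, 'e::euclidean_space) chart set \<Rightarrow> ('m, 'e) chart \<Rightarrow> 'm \<Rightarrow> 'e \<Rightarrow> 'e" where
  "from_coord A c p =
     frechet_derivative (snd (chart_at A p) \<circ> chart_inv c) (at (snd c p))"

text \<open>A vector field assigns to \<open>q\<close> a vector \<open>V q\<close> tangent at \<open>q\<close>; \<open>field_coord A c V\<close> is its
  coordinate representation in the chart \<open>c\<close>.\<close>

definition field_coord ::
    "('m, 'e::euclidean_space) chart set \<Rightarrow> ('m, 'e) chart \<Rightarrow> ('m \<Rightarrow> 'e) \<Rightarrow> 'e \<Rightarrow> 'e" where
  "field_coord A c V x = to_coord A c (chart_inv c x) (V (chart_inv c x))"

definition smooth_field_on ::
    "('m, 'e::euclidean_space) chart set \<Rightarrow> ('m \<Rightarrow> 'e) \<Rightarrow> 'm set \<Rightarrow> bool" where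
  "smooth_field_on A V W \<longleftrightarrow>
     (\<forall>c\<in>A. smooth_on (field_coord A c V) (snd c ` (fst c \<inter> W)))"

text \<open>Smooth curves on an interval \<open>I\<close>, possibly closed: \<open>d n\<close> is the \<open>n\<close>-th derivative of the
  coordinate expression, one-sided at endpoints of \<open>I\<close>.\<close>

definition smooth_curve ::
    "('m::topological_space, 'e::euclidean_space) chart set \<Rightarrow> (real \<Rightarrow> 'm) \<Rightarrow> real set \<Rightarrow> bool" where
  "smooth_curve A \<sigma> I \<longleftrightarrow> continuous_on I \<sigma> \<and>
     (\<forall>c\<in>A. \<exists>d :: nat \<Rightarrow> real \<Rightarrow> 'e. d 0 = snd c \<circ> \<sigma> \<and>
        (\<forall>n. \<forall>t\<in>I. \<sigma> t \<in> fst c \<longrightarrow>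
           (d n has_vector_derivative d (Suc n) t) (at t within I)))"

definition velocity ::
    "('m, 'e::euclidean_space) chart set \<Rightarrow> (real \<Rightarrow> 'm) \<Rightarrow> real set \<Rightarrow> real \<Rightarrow> 'e" where
  "velocity A \<sigma> I t = vector_derivative (snd (chart_at A (\<sigma> t)) \<circ> \<sigma>) (at t within I)"

definition nondegenerate_on :: "('e::real_vector \<Rightarrow> 'e \<Rightarrow> real) \<Rightarrow> 'e set \<Rightarrow> bool" where
  "nondegenerate_on B S \<longleftrightarrow> (\<forall>v\<in>S. (\<forall>w\<in>S. B v w = 0) \<longrightarrow> v = 0)"

text \<open>\<open>g p\<close> is a bilinear form on the tangent space at \<open>p\<close>; \<open>metric_coord A g c x\<close> is its
  expression in the chart \<open>c\<close> at the coordinates \<open>x\<close> of \<open>p\<close>.\<close>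

definition metric_coord ::
    "('m, 'e::euclidean_space) chart set \<Rightarrow> ('m \<Rightarrow> 'e \<Rightarrow> 'e \<Rightarrow> real) \<Rightarrow> ('m, 'e) chart
       \<Rightarrow> 'e \<Rightarrow> 'e \<Rightarrow> 'e \<Rightarrow> real" where
  "metric_coord A g c x u v =
     (let p = chart_inv c x in g p (from_coord A c p u) (from_coord A c p v))"

definition semi_riemannian_metric ::
    "('m, 'e::euclidean_space) chart set \<Rightarrow> ('m \<Rightarrow> 'e \<Rightarrow> 'e \<Rightarrow> real) \<Rightarrow> bool" where
  "semi_riemannian_metric A g \<longleftrightarrow>
     (\<forall>p. bilinear (g p) \<and> (\<forall>v w. g p v w = g p w v) \<and> nondegenerate_on (g p) UNIV) \<and>
     (\<forall>c\<in>A. \<forall>u v. smooth_on (\<lambda>x. metric_coord A g c x u v) (snd c ` fst c))"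

text \<open>The Christoffel symbols in the chart \<open>c\<close>, as a bilinear map: \<open>christoffel A g c x u v\<close> is
  the value at \<open>x\<close> of \<open>\<nabla>\<^sub>u v\<close> for the constant coordinate fields \<open>u\<close>, \<open>v\<close>, given by the Koszul
  formula (the brackets of constant fields vanish).\<close>

definition christoffel ::
    "('m, 'e::euclidean_space) chart set \<Rightarrow> ('m \<Rightarrow> 'e \<Rightarrow> 'e \<Rightarrow> real) \<Rightarrow> ('m, 'e) chart
       \<Rightarrow> 'e \<Rightarrow> 'e \<Rightarrow> 'e \<Rightarrow> 'e" where
  "christoffel A g c x u v =
     (let D = (\<lambda>i j k. frechet_derivative (\<lambda>y. metric_coord A g c y j k) (at x) i)
      in THE z. \<forall>w. 2 * metric_coord A g c x z w = D u v w + D v u w - D w u v)"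

text \<open>The Levi-Civita derivative at \<open>p\<close> of the field \<open>V\<close> in the direction of the tangent vector \<open>v\<close>,
  computed in the chart \<open>chart_at A p\<close>, in which tangent vectors at \<open>p\<close> are their own
  coordinates.\<close>

definition nabla ::
    "('m, 'e::euclidean_space) chart set \<Rightarrow> ('m \<Rightarrow> 'e \<Rightarrow> 'e \<Rightarrow> real) \<Rightarrow> ('m \<Rightarrow> 'e) \<Rightarrow> 'm \<Rightarrow> 'e \<Rightarrow> 'e" where
  "nabla A g V p v =
     (let c = chart_at A p; x = snd c p
      in frechet_derivative (field_coord A c V) (at x) v + christoffel A g c x v (V p))"

definition geodesic ::
    "('m::topological_space, 'e::euclidean_space) chart set \<Rightarrow> ('m \<Rightarrow> 'e \<Rightarrow> 'e \<Rightarrow> real)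
       \<Rightarrow> (real \<Rightarrow> 'm) \<Rightarrow> real \<Rightarrow> real \<Rightarrow> bool" where
  "geodesic A g \<gamma> a b \<longleftrightarrow> smooth_curve A \<gamma> {a..b} \<and>
     (\<forall>c\<in>A. \<forall>t\<in>{a..b}. \<gamma> t \<in> fst c \<longrightarrow>
        (let x = snd c \<circ> \<gamma>; x' = (\<lambda>s. vector_derivative x (at s within {a..b}))
         in vector_derivative x' (at t within {a..b}) + christoffel A g c (x t) (x' t) (x' t) = 0))"

definition submanifold ::
    "('m, 'e::euclidean_space) chart set \<Rightarrow> 'm set \<Rightarrow> bool" where
  "submanifold A P \<longleftrightarrow> (\<exists>k. \<forall>p\<in>P. \<exists>c\<in>A. p \<in> fst c \<and>
     (\<exists>E. subspace E \<and> dim E = k \<and> snd c ` (fst c \<inter> P) = snd c ` fst c \<inter> E))"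

definition tangent_space ::
    "('m::topological_space, 'e::euclidean_space) chart set \<Rightarrow> 'm set \<Rightarrow> 'm \<Rightarrow> 'e set" where
  "tangent_space A P p =
     {velocity A \<sigma> {-\<epsilon>..\<epsilon>} 0 | \<sigma> \<epsilon>.
        \<epsilon> > 0 \<and> smooth_curve A \<sigma> {-\<epsilon>..\<epsilon>} \<and> \<sigma> ` {-\<epsilon>..\<epsilon>} \<subseteq> P \<and> \<sigma> 0 = p}"

definition tangent_extension ::
    "('m::topological_space, 'e::euclidean_space) chart set \<Rightarrow> 'm set \<Rightarrow> 'm \<Rightarrow> 'e \<Rightarrow> ('m \<Rightarrow> 'e) \<Rightarrow> bool" where
  "tangent_extension A P p v V \<longleftrightarrow> V p = v \<and>
     (\<exists>W. open W \<and> p \<in> W \<and> smooth_field_on A V W \<and>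
        (\<forall>q\<in>P \<inter> W. V q \<in> tangent_space A P q))"

text \<open>The operator \<open>S\<close> on \<open>T\<^sub>p P\<close> with \<open>g (S v) v' = g (\<nabla>\<^sub>v V') n\<close>; meaningful if \<open>n\<close> is normal to \<open>P\<close>
  at \<open>p\<close> and \<open>g\<close> is nondegenerate on \<open>T\<^sub>p P\<close>.\<close>

definition shape_operator ::
    "('m::topological_space, 'e::euclidean_space) chart set \<Rightarrow> ('m \<Rightarrow> 'e \<Rightarrow> 'e \<Rightarrow> real)
       \<Rightarrow> 'm set \<Rightarrow> 'm \<Rightarrow> 'e \<Rightarrow> 'e \<Rightarrow> 'e" where
  "shape_operator A g P p n v =
     (THE s. s \<in> tangent_space A P p \<and>
        (\<forall>v'\<in>tangent_space A P p. \<forall>V'. tangent_extension A P p v' V' \<longrightarrow>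
           g p s v' = g p (nabla A g V' p v) n))"

definition g_perp :: "('e \<Rightarrow> 'e \<Rightarrow> real) \<Rightarrow> 'e set \<Rightarrow> 'e set" where
  "g_perp B S = {w. \<forall>v\<in>S. B v w = 0}"

definition symp :: "('e \<Rightarrow> 'e \<Rightarrow> real) \<Rightarrow> 'e \<times> 'e \<Rightarrow> 'e \<times> 'e \<Rightarrow> real" where
  "symp B x y = B (fst y) (snd x) - B (fst x) (snd y)"

definition lagrangian :: "('e::euclidean_space \<Rightarrow> 'e \<Rightarrow> real) \<Rightarrow> ('e \<times> 'e) set \<Rightarrow> bool" where
  "lagrangian B L \<longleftrightarrow>
     subspace L \<and> (\<forall>x\<in>L. \<forall>y\<in>L. symp B x y = 0) \<and> dim L = DIM('e)"

definition submanifold_lagrangian ::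
    "('m::topological_space, 'e::euclidean_space) chart set \<Rightarrow> ('m \<Rightarrow> 'e \<Rightarrow> 'e \<Rightarrow> real)
       \<Rightarrow> 'm set \<Rightarrow> 'm \<Rightarrow> 'e \<Rightarrow> ('e \<times> 'e) set" where
  "submanifold_lagrangian A g P p n =
     {(v, w). v \<in> tangent_space A P p \<and>
        w + shape_operator A g P p n v \<in> g_perp (g p) (tangent_space A P p)}"

end

theory Submission
  imports Defs
begin

text \<open>The data \<open>L\<close> amounts to the subspace \<open>E = fst ` L\<close> together with a symmetric bilinear form on it:
  \<open>L\<close> is the set of all \<open>(v, w)\<close> with \<open>v \<in> E\<close> and \<open>w - \<omega> v\<close> orthogonal to \<open>E\<close>, for a linear map
  \<open>\<omega>\<close> such that \<open>g (\<omega> v) v'\<close> is symmetric in \<open>v, v' \<in> E\<close> (\<open>lagrangian_graph\<close>, a dimension count).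
  Comparing with the definition of \<open>L\<^sub>P\<close>, a submanifold through \<open>p = \<gamma> a\<close> is needed whose tangent
  space at \<open>p\<close> is \<open>E\<close> and whose second fundamental form in the direction \<open>n\<close> of the initial velocity
  is \<open>- g (\<omega> v) v'\<close>.

  Such a submanifold is a quadratic graph in a chart at \<open>p\<close>. Let \<open>x\<^sub>0\<close> be the coordinates of \<open>p\<close>,
  let \<open>\<pi>\<close> be the \<open>g\<close>-orthogonal projection onto \<open>E\<close>, and let \<open>m\<close> be a vector with \<open>\<pi> m = 0\<close> and
  \<open>g m n = 1\<close>; it exists because \<open>n\<close> is a nonzero vector orthogonal to \<open>E\<close>. For a symmetric bilinear
  form \<open>Q\<close> with \<open>Q u v = Q (\<pi> u) (\<pi> v)\<close> the shear \<open>z \<mapsto> x\<^sub>0 + z + Q z z / 2 * m\<close> is a polynomial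
  diffeomorphism with polynomial inverse, so that composing the chart with its inverse
  gives a chart of the maximal atlas, and the points whose new coordinates lie in \<open>E\<close> form a
  submanifold (\<open>ex_submanifold_second_fundamental_form\<close>). Differentiating a tangent field \<open>V\<close> along
  this submanifold in the direction \<open>u\<close> gives \<open>Q u (V p) * m\<close> in coordinates, up to a vector of \<open>E\<close>.
  Pairing with \<open>n\<close> and adding the contribution of the Christoffel symbols yields the second fundamental
  form \<open>Q u v + g (\<Gamma> u v) n\<close>, so \<open>Q\<close> is determined by the prescribed one
  (\<open>ex_submanifold_lagrangian\<close>).

  It remains to see that \<open>n \<noteq> 0\<close>. In a chart the geodesic equation bounds the second derivative of
  \<open>\<gamma>\<close> by a multiple of the square of the first, because the Christoffel symbols are locally bounded
  (\<open>christoffel_bound\<close>). Hence near each point a velocity that vanishes once vanishes throughout, and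
  by connectedness of the interval a geodesic with a zero velocity is constant
  (\<open>nonconstant_geodesic_velocity_nonzero\<close>).\<close>

section \<open>Calculus of smooth maps\<close>

lemma ck_on_subset: "ck_on k f T \<Longrightarrow> S \<subseteq> T \<Longrightarrow> ck_on k f S"
  by (induction k arbitrary: f) (auto intro: continuous_on_subset)

lemma ck_on_SucD: "ck_on (Suc k) f S \<Longrightarrow> ck_on k f S"
proof (induction k arbitrary: f)
  case 0
  then show ?case
    by (auto intro!: continuous_at_imp_continuous_on differentiable_imp_continuous_within)
next
  case (Suc k)
  then show ?case by (auto simp del: ck_on.simps(2) simp: ck_on.simps(2)[of "Suc k"] ck_on.simps(2)[of k])
qed

lemma ck_on_Suc_has_derivative:
  assumes "ck_on (Suc k) f S" "x \<in> S"
  shows "(f has_derivative frechet_derivative f (at x)) (at x)"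
proof -
  have "f differentiable (at x)"
    using assms by auto
  then show ?thesis
    unfolding frechet_derivative_works .
qed

lemma frechet_derivative_cong_open:
  assumes "open S" "x \<in> S" "\<And>y. y \<in> S \<Longrightarrow> f y = g y"
  shows "frechet_derivative f (at x) = frechet_derivative g (at x)"
    and "f differentiable (at x) \<longleftrightarrow> g differentiable (at x)"
proof -
  have "(f has_derivative D) (at x) \<longleftrightarrow> (g has_derivative D) (at x)" for D
    using assms has_derivative_transform_within_open[of _ _ x UNIV S] by metis
  then show "frechet_derivative f (at x) = frechet_derivative g (at x)"
    and "f differentiable (at x) \<longleftrightarrow> g differentiable (at x)"
    by (auto simp: frechet_derivative_def differentiable_def)
qed

text \<open>The value at a point of any iterated derivative depends only on the germ of the map there, so that on
  an open set \<open>ck_on\<close> does not see the values of the map outside.\<close>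

lemma ck_on_cong:
  assumes "open S"
  shows "(\<And>x. x \<in> S \<Longrightarrow> f x = g x) \<Longrightarrow> ck_on k f S \<longleftrightarrow> ck_on k g S"
proof (induction k arbitrary: f g)
  case 0
  then show ?case by (simp cong: continuous_on_cong)
next
  case (Suc k)
  note eq = frechet_derivative_cong_open[OF assms _ Suc.prems]
  have "ck_on k (\<lambda>x. frechet_derivative f (at x) v) S \<longleftrightarrow>
        ck_on k (\<lambda>x. frechet_derivative g (at x) v) S" for v
    by (rule Suc.IH) (simp add: eq(1))
  then show ?case using eq(2) by auto
qed

lemma ck_on_Suc_if_has_derivative:
  assumes "open S" "\<And>x. x \<in> S \<Longrightarrow> (f has_derivative f' x) (at x)"
    and "\<And>v. ck_on k (\<lambda>x. f' x v) S"
  shows "ck_on (Suc k) f S"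
proof -
  have "frechet_derivative f (at x) = f' x" if "x \<in> S" for x
    using assms(2)[OF that] frechet_derivative_at by metis
  then have "ck_on k (\<lambda>x. frechet_derivative f (at x) v) S" for v
    using ck_on_cong[OF assms(1), of "\<lambda>x. frechet_derivative f (at x) v" "\<lambda>x. f' x v"] assms(3)
    by auto
  then show ?thesis using assms(2) by (auto simp: differentiable_def)
qed

lemma ck_on_const: "open S \<Longrightarrow> ck_on k (\<lambda>x. c) S"
proof (induction k arbitrary: c)
  case (Suc k)
  show ?case
    by (rule ck_on_Suc_if_has_derivative[where f' = "\<lambda>x v. 0"])
       (auto intro: Suc derivative_eq_intros)
qed simp

lemma ck_on_bounded_linear:
  assumes "open S" "bounded_linear L" shows "ck_on k L S"
proof (cases k)
  case 0
  then show ?thesis by (simp add: assms(2) linear_continuous_on)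
next
  case (Suc m)
  have "ck_on (Suc m) L S"
    by (rule ck_on_Suc_if_has_derivative[where f' = "\<lambda>x v. L v"])
       (auto intro: assms ck_on_const bounded_linear_imp_has_derivative)
  then show ?thesis using Suc by simp
qed

lemma ck_on_bounded_linear_comp:
  assumes "open S" "bounded_linear L"
  shows "ck_on k f S \<Longrightarrow> ck_on k (\<lambda>x. L (f x)) S"
proof (induction k arbitrary: f)
  case 0
  then show ?case using bounded_linear.continuous_on[OF assms(2)] by auto
next
  case (Suc k)
  show ?case
  proof (rule ck_on_Suc_if_has_derivative[OF assms(1)])
    fix x assume "x \<in> S"
    then have "(f has_derivative frechet_derivative f (at x)) (at x)"
      by (rule Suc.prems[THEN ck_on_Suc_has_derivative])
    then show "((\<lambda>x. L (f x)) has_derivative (\<lambda>v. L (frechet_derivative f (at x) v))) (at x)"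
      by (rule bounded_linear.has_derivative[OF assms(2)])
  next
    show "ck_on k (\<lambda>x. L (frechet_derivative f (at x) v)) S" for v
      using Suc by auto
  qed
qed

lemma ck_on_add:
  assumes "open S"
  shows "ck_on k f S \<Longrightarrow> ck_on k g S \<Longrightarrow> ck_on k (\<lambda>x. f x + g x) S"
proof (induction k arbitrary: f g)
  case 0
  then show ?case by (auto intro: continuous_on_add)
next
  case (Suc k)
  show ?case
  proof (rule ck_on_Suc_if_has_derivative[OF assms(1)])
    fix x assume "x \<in> S"
    then show "((\<lambda>x. f x + g x) has_derivative
        (\<lambda>v. frechet_derivative f (at x) v + frechet_derivative g (at x) v)) (at x)"
      by (intro has_derivative_add Suc.prems[THEN ck_on_Suc_has_derivative])
  next
    show "ck_on k (\<lambda>x. frechet_derivative f (at x) v + frechet_derivative g (at x) v) S" for v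
      using Suc by auto
  qed
qed

lemma ck_on_sum:
  assumes "open S" "\<And>i. i \<in> I \<Longrightarrow> ck_on k (f i) S"
  shows "ck_on k (\<lambda>x. \<Sum>i\<in>I. f i x) S"
  using assms(2)
  by (induction I rule: infinite_finite_induct)
     (auto simp: ck_on_const[OF assms(1)] intro: ck_on_add[OF assms(1)])

lemma ck_on_scaleR:
  fixes a :: "_ \<Rightarrow> real"
  assumes "open S"
  shows "ck_on k a S \<Longrightarrow> ck_on k f S \<Longrightarrow> ck_on k (\<lambda>x. a x *\<^sub>R f x) S"
proof (induction k arbitrary: a f)
  case 0
  then show ?case by (auto intro: continuous_on_scaleR)
next
  case (Suc k)
  show ?case
  proof (rule ck_on_Suc_if_has_derivative[OF assms(1)])
    fix x assume "x \<in> S"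
    then show "((\<lambda>x. a x *\<^sub>R f x) has_derivative
        (\<lambda>v. a x *\<^sub>R frechet_derivative f (at x) v + frechet_derivative a (at x) v *\<^sub>R f x)) (at x)"
      by (intro has_derivative_scaleR Suc.prems[THEN ck_on_Suc_has_derivative])
  next
    show "ck_on k (\<lambda>x. a x *\<^sub>R frechet_derivative f (at x) v
        + frechet_derivative a (at x) v *\<^sub>R f x) S" for v
      using Suc.prems ck_on_SucD[OF Suc.prems(1)] ck_on_SucD[OF Suc.prems(2)]
      by (intro ck_on_add assms Suc.IH) auto
  qed
qed

lemma linear_expand_Basis:
  fixes L :: "'a::euclidean_space \<Rightarrow> 'b::real_vector"
  assumes "linear L" shows "L v = (\<Sum>b\<in>Basis. (v \<bullet> b) *\<^sub>R L b)"
proof -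
  have "L v = L (\<Sum>b\<in>Basis. (v \<bullet> b) *\<^sub>R b)"
    by (simp add: euclidean_representation)
  also have "\<dots> = (\<Sum>b\<in>Basis. (v \<bullet> b) *\<^sub>R L b)"
    by (simp add: linear_sum[OF assms] linear_scale[OF assms])
  finally show ?thesis .
qed

text \<open>By the chain rule, the derivative of \<open>f \<circ> g\<close> in direction \<open>v\<close> is the sum over the basis vectors
  \<open>b\<close> of the \<open>b\<close>-component of \<open>g' v\<close> times \<open>(f' b) \<circ> g\<close>. The factors are of class \<open>k\<close> when \<open>f\<close> and \<open>g\<close>
  are of class \<open>k + 1\<close>, the second one by induction.\<close>

lemma ck_on_compose:
  fixes f :: "'b::euclidean_space \<Rightarrow> 'c::real_normed_vector"
  assumes "open S" "open T"
  shows "ck_on k f T \<Longrightarrow> ck_on k g S \<Longrightarrow> g ` S \<subseteq> T \<Longrightarrow> ck_on k (f \<circ> g) S"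
proof (induction k arbitrary: f)
  case 0
  then show ?case
    using continuous_on_compose[of S g f] continuous_on_subset[of T f "g ` S"] by auto
next
  case (Suc k)
  have df: "(f has_derivative frechet_derivative f (at (g x))) (at (g x))" if "x \<in> S" for x
    using that Suc.prems by (intro ck_on_Suc_has_derivative[OF Suc.prems(1)]) auto
  note dg = ck_on_Suc_has_derivative[OF Suc.prems(2)]
  show ?case
  proof (rule ck_on_Suc_if_has_derivative[OF assms(1)])
    fix x assume x: "x \<in> S"
    have "linear (frechet_derivative f (at (g x)))"
      using df[OF x] has_derivative_linear by blast
    then have "frechet_derivative f (at (g x)) \<circ> frechet_derivative g (at x) =
        (\<lambda>v. \<Sum>b\<in>Basis. (frechet_derivative g (at x) v \<bullet> b) *\<^sub>R
          ((\<lambda>y. frechet_derivative f (at y) b) \<circ> g) x)"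
      unfolding o_def by (intro ext) (rule linear_expand_Basis)
    then show "((f \<circ> g) has_derivative (\<lambda>v. \<Sum>b\<in>Basis. (frechet_derivative g (at x) v \<bullet> b) *\<^sub>R
         ((\<lambda>y. frechet_derivative f (at y) b) \<circ> g) x)) (at x)"
      using diff_chain_at[OF dg[OF x] df[OF x]] by (simp only:)
  next
    fix v
    have g: "ck_on k g S" using Suc.prems ck_on_SucD by blast
    have 1: "ck_on k ((\<lambda>y. frechet_derivative f (at y) b) \<circ> g) S" for b
      using Suc.prems g by (intro Suc.IH) auto
    have 2: "ck_on k (\<lambda>x. frechet_derivative g (at x) v \<bullet> b) S" for b
      using Suc.prems by (intro ck_on_bounded_linear_comp[OF assms(1) bounded_linear_inner_left]) auto
    show "ck_on k (\<lambda>x. \<Sum>b\<in>Basis. (frechet_derivative g (at x) v \<bullet> b) *\<^sub>R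
         ((\<lambda>y. frechet_derivative f (at y) b) \<circ> g) x) S"
      by (intro ck_on_sum ck_on_scaleR assms 1 2)
  qed
qed

lemma smooth_on_compose:
  fixes f :: "'b::euclidean_space \<Rightarrow> 'c::real_normed_vector"
  shows "open S \<Longrightarrow> open T \<Longrightarrow> smooth_on f T \<Longrightarrow> smooth_on g S \<Longrightarrow> g ` S \<subseteq> T \<Longrightarrow>
    smooth_on (f \<circ> g) S"
  by (auto simp: smooth_on_def intro: ck_on_compose)

lemma smooth_on_cong:
  "open S \<Longrightarrow> (\<And>x. x \<in> S \<Longrightarrow> f x = g x) \<Longrightarrow> smooth_on f S \<longleftrightarrow> smooth_on g S"
  using ck_on_cong unfolding smooth_on_def by blast

lemma smooth_on_subset: "smooth_on f T \<Longrightarrow> S \<subseteq> T \<Longrightarrow> smooth_on f S"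
  using ck_on_subset unfolding smooth_on_def by blast

lemma smooth_on_derivative:
  "smooth_on f S \<Longrightarrow> smooth_on (\<lambda>x. frechet_derivative f (at x) v) S"
  unfolding smooth_on_def using ck_on.simps(2) by blast

lemma smooth_on_has_derivative:
  "smooth_on f S \<Longrightarrow> x \<in> S \<Longrightarrow> (f has_derivative frechet_derivative f (at x)) (at x)"
  unfolding smooth_on_def by (rule ck_on_Suc_has_derivative[of 0]) blast

lemma smooth_on_continuous_on: "smooth_on f S \<Longrightarrow> continuous_on S f"
  unfolding smooth_on_def using ck_on.simps(1) by blast

lemma smooth_on_add:
  "open S \<Longrightarrow> smooth_on f S \<Longrightarrow> smooth_on g S \<Longrightarrow> smooth_on (\<lambda>x. f x + g x) S"
  unfolding smooth_on_def using ck_on_add by blast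

lemma smooth_on_const: "open S \<Longrightarrow> smooth_on (\<lambda>x. c) S"
  unfolding smooth_on_def using ck_on_const by blast

lemma smooth_on_affine:
  assumes "open S" "bounded_linear L" shows "smooth_on (\<lambda>x. c + L x) S"
  by (intro smooth_on_add smooth_on_const assms)
     (simp add: smooth_on_def ck_on_bounded_linear assms)

lemma smooth_on_if_derivative:
  assumes "open S" "\<And>x. x \<in> S \<Longrightarrow> (f has_derivative f' x) (at x)"
    and "\<And>v. smooth_on (\<lambda>x. f' x v) S"
  shows "smooth_on f S"
  unfolding smooth_on_def
proof
  show "ck_on k f S" for k
    using ck_on_SucD[OF ck_on_Suc_if_has_derivative[OF assms(1,2)]] assms(3)
    unfolding smooth_on_def by blast
qed

text \<open>For functions of a real variable the derivative is applied to the direction \<open>1\<close>; this provides the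
  sequences of higher derivatives that smooth curves require.\<close>

lemma smooth_on_frechet_iterates:
  fixes f :: "real \<Rightarrow> 'b::real_normed_vector"
  assumes "smooth_on f S"
  shows "smooth_on (((\<lambda>h t. frechet_derivative h (at t) 1) ^^ n) f) S"
  by (induction n) (simp_all add: assms smooth_on_derivative)

lemma has_vector_derivative_in_subspace:
  fixes f :: "real \<Rightarrow> 'e::euclidean_space"
  assumes "(f has_vector_derivative u) (at t within I)" "t \<in> I" "\<not> trivial_limit (at t within I)"
    and "\<delta> > 0" "\<And>s. s \<in> I \<Longrightarrow> dist s t < \<delta> \<Longrightarrow> f s \<in> E" "subspace E"
  shows "u \<in> E"
proof -
  have "z \<bullet> u = 0" if z: "z \<in> orthogonal_comp E" for z
  proof -
    have "((\<lambda>s. z \<bullet> f s) has_vector_derivative z \<bullet> u) (at t within I)"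
      using bounded_linear.has_vector_derivative[OF bounded_linear_inner_right assms(1)] .
    moreover have "((\<lambda>s. z \<bullet> f s) has_vector_derivative 0) (at t within I)"
    proof (rule has_vector_derivative_transform_within[OF _ assms(4) assms(2)])
      show "((\<lambda>s. 0) has_vector_derivative 0) (at t within I)" by simp
      show "0 = z \<bullet> f s" if "s \<in> I" "dist s t < \<delta>" for s
        using assms(5)[OF that] z by (auto simp: orthogonal_comp_def orthogonal_def inner_commute)
    qed
    ultimately show ?thesis
      using vector_derivative_unique_within[OF assms(3)] by blast
  qed
  then have "u \<in> orthogonal_comp (orthogonal_comp E)"
    by (simp add: orthogonal_comp_def orthogonal_def)
  then show ?thesis using orthogonal_comp_self[OF assms(6)] by simp
qed

lemma vector_derivative_mean_value_bound:
  fixes f :: "real \<Rightarrow> 'b::real_normed_vector"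
  assumes "convex S" "\<And>t. t \<in> S \<Longrightarrow> (f has_vector_derivative f' t) (at t within S)"
    and "\<And>t. t \<in> S \<Longrightarrow> norm (f' t) \<le> B" "s \<in> S" "t \<in> S"
  shows "norm (f t - f s) \<le> B * \<bar>t - s\<bar>"
proof -
  have "norm (f t - f s) \<le> B * norm (t - s)"
  proof (rule differentiable_bound[OF assms(1)])
    fix x assume x: "x \<in> S"
    show "(f has_derivative (\<lambda>h. h *\<^sub>R f' x)) (at x within S)"
      using assms(2)[OF x] unfolding has_vector_derivative_def .
    show "onorm (\<lambda>h. h *\<^sub>R f' x) \<le> B"
    proof (rule onorm_le)
      show "norm (h *\<^sub>R f' x) \<le> B * norm h" for h
        using mult_right_mono[OF assms(3)[OF x], of "\<bar>h\<bar>"] by (simp add: mult.commute)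
    qed
  qed (use assms in auto)
  then show ?thesis by simp
qed

text \<open>A special case of Gronwall's lemma on an interval so short that no exponential is needed: by
  the mean value inequality, the supremum of \<open>norm (y t)\<close> is at most half of itself.\<close>

lemma zero_if_derivative_small:
  fixes y :: "real \<Rightarrow> 'b::real_normed_vector"
  assumes "convex J" "\<And>t. t \<in> J \<Longrightarrow> (y has_vector_derivative y' t) (at t within J)"
    and "\<And>t. t \<in> J \<Longrightarrow> norm (y t) \<le> M"
    and "\<And>t. t \<in> J \<Longrightarrow> norm (y' t) \<le> k * norm (y t)" "k \<ge> 0"
    and "\<And>t. t \<in> J \<Longrightarrow> k * \<bar>t - s\<bar> \<le> 1 / 2"
    and "s \<in> J" "y s = 0" "t \<in> J"
  shows "y t = 0"
proof -
  define B where "B = (SUP t\<in>J. norm (y t))"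
  have bdd: "bdd_above ((\<lambda>t. norm (y t)) ` J)"
    using assms(3) by (auto simp: bdd_above_def)
  have le: "norm (y t) \<le> B" if "t \<in> J" for t
    unfolding B_def using bdd that by (rule cSUP_upper2) simp
  have B0: "B \<ge> 0" using le[OF assms(7)] by (simp add: assms(8))
  have "norm (y t) \<le> B / 2" if t: "t \<in> J" for t
  proof -
    have "norm (y t - y s) \<le> (k * B) * \<bar>t - s\<bar>"
    proof (rule vector_derivative_mean_value_bound[OF assms(1,2) _ assms(7) t])
      fix u assume u: "u \<in> J"
      then show "norm (y' u) \<le> k * B"
        using assms(4)[OF u] mult_left_mono[OF le[OF u] assms(5)] by linarith
    qed
    also have "\<dots> = (k * \<bar>t - s\<bar>) * B" by simp
    also have "\<dots> \<le> 1 / 2 * B" by (rule mult_right_mono[OF assms(6)[OF t] B0])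
    finally show ?thesis by (simp add: assms(8))
  qed
  then have "B \<le> B / 2" unfolding B_def using assms(7) by (intro cSUP_least) auto
  then show ?thesis using le[OF assms(9)] B0 by simp
qed

section \<open>Nondegenerate forms and Lagrangian subspaces\<close>

text \<open>Riesz representation for a form that is nondegenerate on the subspace \<open>S\<close>. The map \<open>T\<close> sends \<open>z\<close> to the
  vector of \<open>S\<close> that represents \<open>B z\<close> on \<open>S\<close> with respect to the inner product; it is injective on \<open>S\<close>,
  hence onto.\<close>

lemma bilinear_form_represents_on:
  fixes B :: "'e::euclidean_space \<Rightarrow> 'e \<Rightarrow> real"
  assumes B: "bilinear B" and S: "subspace S" and nondeg: "nondegenerate_on B S" and f: "linear f"
  shows "\<exists>!z. z \<in> S \<and> (\<forall>w\<in>S. B z w = f w)"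
proof -
  obtain N where N: "N \<subseteq> S" "pairwise orthogonal N" "\<And>x. x \<in> N \<Longrightarrow> norm x = 1"
    "independent N" "span N = S"
    using orthonormal_basis_subspace[OF S] by metis
  then have fin: "finite N" using independent_imp_finite by blast
  define T where "T z = (\<Sum>b\<in>N. B z b *\<^sub>R b)" for z
  have ortho: "(\<Sum>b'\<in>N. h b' *\<^sub>R b') \<bullet> b = h b" if b: "b \<in> N" for h b
  proof -
    have "b' \<bullet> b = (if b' = b then 1 else 0)" if "b' \<in> N" for b'
      using N(2,3) b that by (auto simp: pairwise_def orthogonal_def dot_square_norm)
    then have "(\<Sum>b'\<in>N. h b' *\<^sub>R b') \<bullet> b = (\<Sum>b'\<in>N. if b' = b then h b' else 0)"
      unfolding inner_sum_left by (intro sum.cong) auto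
    then show ?thesis using b fin by simp
  qed
  have lin: "linear (B z)" for z using B bilinear_def by blast
  have eqI: "B z w = h w" if "\<And>b. b \<in> N \<Longrightarrow> B z b = h b" "linear h" "w \<in> S" for z w h
    using linear_eq_on[OF lin that(2), of w N z] that(1,3) N(5) by simp
  have linT: "linear T"
    unfolding T_def using B
    by (intro linearI) (simp_all add: bilinear_ladd bilinear_lmul scaleR_add_left sum.distrib scaleR_sum_right)
  have T0: "z = 0" if z: "z \<in> S" "T z = 0" for z
  proof -
    have "B z b = 0" if "b \<in> N" for b
      using ortho[OF that, of "B z"] z(2) by (simp add: T_def)
    then have "B z w = 0" if "w \<in> S" for w
      using eqI[of z "\<lambda>_. 0", OF _ _ that] by (simp add: linear_iff)
    then show ?thesis using nondeg z(1) unfolding nondegenerate_on_def by blast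
  qed
  have "inj_on T S"
    using linear_inj_on_iff_eq_0[OF linT S] T0 by blast
  then have "inj_on T (span S)" unfolding span_eq_iff[THEN iffD2, OF S] .
  then have dim: "dim (T ` S) = dim S" by (rule dim_image_eq[OF linT])
  have "T ` S \<subseteq> S"
    unfolding T_def using S N(1) by (auto intro!: subspace_sum subspace_scale)
  then have "T ` S = S"
    using dim by (intro subspace_dim_equal linear_subspace_image linT S) auto
  moreover have "(\<Sum>b\<in>N. f b *\<^sub>R b) \<in> S"
    using S N(1) by (auto intro!: subspace_sum subspace_scale)
  ultimately obtain z where z: "z \<in> S" "T z = (\<Sum>b\<in>N. f b *\<^sub>R b)"
    by (metis imageE)
  have "B z b = f b" if "b \<in> N" for b
    using ortho[OF that, of "B z"] ortho[OF that, of f] z(2) unfolding T_def by simp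
  then have ex: "\<forall>w\<in>S. B z w = f w" using eqI f by blast
  have unique: "z = z'" if "z' \<in> S" "\<forall>w\<in>S. B z' w = f w" for z'
  proof -
    have "\<forall>w\<in>S. B (z - z') w = 0" using ex that(2) B by (simp add: bilinear_lsub)
    moreover have "z - z' \<in> S" using z(1) that(1) S by (simp add: subspace_diff)
    ultimately have "z - z' = 0" using nondeg unfolding nondegenerate_on_def by blast
    then show ?thesis by simp
  qed
  show ?thesis using z(1) ex unique by blast
qed

lemma subspace_g_perp: "bilinear B \<Longrightarrow> subspace (g_perp B S)"
  by (auto simp: g_perp_def subspace_def bilinear_rzero bilinear_radd bilinear_rmul)

text \<open>Nondegeneracy on \<open>S\<close> is what makes the projection well defined for an indefinite form.\<close>

lemma g_orthogonal_projection:
  fixes B :: "'e::euclidean_space \<Rightarrow> 'e \<Rightarrow> real"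
  assumes B: "bilinear B" and sym: "\<And>v w. B v w = B w v"
    and S: "subspace S" and nondeg: "nondegenerate_on B S"
  obtains \<pi> where "linear \<pi>" "\<And>y. \<pi> y \<in> S" "\<And>v. v \<in> S \<Longrightarrow> \<pi> v = v"
    "\<And>y. y - \<pi> y \<in> g_perp B S" "\<And>y. y \<in> g_perp B S \<Longrightarrow> \<pi> y = 0"
proof -
  have ex: "\<exists>!z. z \<in> S \<and> (\<forall>w\<in>S. B z w = B y w)" for y
    by (rule bilinear_form_represents_on[OF B S nondeg]) (use B bilinear_def in blast)
  define \<pi> where "\<pi> y = (THE z. z \<in> S \<and> (\<forall>w\<in>S. B z w = B y w))" for y
  have \<pi>: "\<pi> y \<in> S" "\<And>w. w \<in> S \<Longrightarrow> B (\<pi> y) w = B y w" for y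
    using theI'[OF ex[of y]] unfolding \<pi>_def by blast+
  have eqI: "\<pi> y = z" if "z \<in> S" "\<And>w. w \<in> S \<Longrightarrow> B z w = B y w" for y z
    unfolding \<pi>_def by (rule the1_equality[OF ex]) (use that in blast)
  show thesis
  proof (rule that)
    show "linear \<pi>"
    proof (rule linearI)
      show "\<pi> (x + y) = \<pi> x + \<pi> y" for x y
        by (rule eqI) (simp_all add: S subspace_add \<pi> bilinear_ladd[OF B])
      show "\<pi> (r *\<^sub>R x) = r *\<^sub>R \<pi> x" for r x
        by (rule eqI) (simp_all add: S subspace_scale \<pi> bilinear_lmul[OF B])
    qed
    show "\<pi> y \<in> S" for y by (rule \<pi>)
    show "\<pi> v = v" if "v \<in> S" for v by (rule eqI) (use that in auto)
    show "y - \<pi> y \<in> g_perp B S" for y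
      using \<pi>(2) by (simp add: g_perp_def bilinear_rsub[OF B] sym[of _ y] sym[of _ "\<pi> y"])
    show "\<pi> y = 0" if "y \<in> g_perp B S" for y
      by (rule eqI) (use that S sym[of y] in \<open>simp_all add: subspace_0 bilinear_lzero[OF B] g_perp_def\<close>)
  qed
qed

text \<open>The map \<open>\<omega>\<close> is a linear section of the first projection of \<open>L\<close>. Its symmetry is the isotropy of
  \<open>L\<close>. Isotropy also puts the kernel of the first projection inside the orthogonal complement of
  \<open>fst ` L\<close>, and equality follows by counting dimensions.\<close>

lemma lagrangian_graph:
  fixes B :: "'e::euclidean_space \<Rightarrow> 'e \<Rightarrow> real"
  assumes B: "bilinear B" and sym: "\<And>v w. B v w = B w v"
    and L: "lagrangian B L" and nondeg: "nondegenerate_on B (fst ` L)"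
  obtains \<omega> where "linear \<omega>" "\<And>v v'. v \<in> fst ` L \<Longrightarrow> v' \<in> fst ` L \<Longrightarrow> B (\<omega> v) v' = B (\<omega> v') v"
    "L = {(v, w). v \<in> fst ` L \<and> w - \<omega> v \<in> g_perp B (fst ` L)}"
proof -
  let ?P = "fst ` L"
  have subL: "subspace L" and iso: "\<And>x y. x \<in> L \<Longrightarrow> y \<in> L \<Longrightarrow> B (fst y) (snd x) = B (fst x) (snd y)"
    and dimL: "dim L = DIM('e)"
    using L by (auto simp: lagrangian_def symp_def)
  have subP: "subspace ?P" by (rule linear_subspace_image[OF linear_fst subL])
  obtain G where G: "range G \<subseteq> L" "linear G" "\<forall>v\<in>?P. fst (G v) = v"
    using linear_exists_right_inverse_on[OF linear_fst subL] by blast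
  define \<omega> where "\<omega> v = snd (G v)" for v
  have \<omega>: "(v, \<omega> v) \<in> L" if "v \<in> ?P" for v
    using G(1,3) that unfolding \<omega>_def by (metis prod.collapse rangeI subsetD)
  define K where "K = {w. (0, w) \<in> L}"
  have subK: "subspace K"
  proof -
    have "K = Pair 0 -` L" by (auto simp: K_def)
    moreover have "linear (Pair (0::'e) :: 'e \<Rightarrow> 'e \<times> 'e)" by (intro linearI) auto
    ultimately show ?thesis using linear_subspace_vimage subL by metis
  qed
  have KP: "K \<subseteq> g_perp B ?P"
  proof
    fix w assume "w \<in> K"
    then show "w \<in> g_perp B ?P"
      using iso[of "(0, w)"] by (auto simp: K_def g_perp_def bilinear_lzero[OF B])
  qed
  \<comment> \<open>The kernel and the image of the section together span \<open>L\<close>, so the kernel has at least the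
    dimension of the orthogonal complement.\<close>
  have "DIM('e) \<le> dim K + dim ?P"
  proof -
    let ?X = "Pair (0::'e) ` K" and ?Y = "G ` ?P"
    have lin0: "linear (Pair (0::'e) :: 'e \<Rightarrow> 'e \<times> 'e)" by (intro linearI) auto
    have "L \<subseteq> {x + y |x y. x \<in> ?X \<and> y \<in> ?Y}"
    proof
      fix z assume z: "z \<in> L"
      then have Gz: "G (fst z) \<in> L" "fst (G (fst z)) = fst z" using G by auto
      have "z - G (fst z) \<in> L" using z Gz subL by (simp add: subspace_diff)
      moreover have "z - G (fst z) = (0, snd z - snd (G (fst z)))" using Gz(2) by (simp add: prod_eq_iff)
      ultimately have "z - G (fst z) \<in> ?X" by (simp add: K_def)
      moreover have "G (fst z) \<in> ?Y" using z by blast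
      moreover have "z = (z - G (fst z)) + G (fst z)" by simp
      ultimately show "z \<in> {x + y |x y. x \<in> ?X \<and> y \<in> ?Y}" by blast
    qed
    then have "dim L \<le> dim {x + y |x y. x \<in> ?X \<and> y \<in> ?Y}" by (rule dim_subset)
    also have "\<dots> \<le> dim ?X + dim ?Y"
      using dim_sums_Int[OF linear_subspace_image[OF lin0 subK] linear_subspace_image[OF G(2) subP]]
      by linarith
    also have "\<dots> \<le> dim K + dim ?P"
      by (intro add_mono dim_image_le lin0 G(2))
    finally show ?thesis using dimL by simp
  qed
  moreover have "dim (g_perp B ?P) + dim ?P \<le> DIM('e)"
  proof -
    have "?P \<inter> g_perp B ?P \<subseteq> {0}"
      using nondeg sym by (auto simp: nondegenerate_on_def g_perp_def)
    then have "dim (g_perp B ?P \<inter> ?P) = 0"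
      by (subst dim_eq_0) blast
    then show ?thesis
      using dim_sums_Int[OF subspace_g_perp[OF B] subP, of ?P]
        dim_subset_UNIV[of "{x + y |x y. x \<in> g_perp B ?P \<and> y \<in> ?P}"] by linarith
  qed
  ultimately have K: "K = g_perp B ?P"
    by (intro subspace_dim_equal subK subspace_g_perp[OF B] KP) linarith
  show thesis
  proof (rule that)
    show "linear \<omega>"
      unfolding \<omega>_def using linear_compose[OF G(2) linear_snd] by (simp add: o_def)
    show "B (\<omega> v) v' = B (\<omega> v') v" if "v \<in> ?P" "v' \<in> ?P" for v v'
      using iso[OF \<omega>[OF that(1)] \<omega>[OF that(2)]] by (simp add: sym[of _ "\<omega> _"])
    have "(v, w) \<in> L \<longleftrightarrow> w - \<omega> v \<in> K" if "v \<in> ?P" for v w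
    proof -
      have "(v, w) = (0, w - \<omega> v) + (v, \<omega> v)" "(0, w - \<omega> v) = (v, w) - (v, \<omega> v)" by auto
      then show ?thesis
        unfolding K_def using subspace_add[OF subL] subspace_diff[OF subL] \<omega>[OF that]
        by (metis mem_Collect_eq)
    qed
    then show "L = {(v, w). v \<in> ?P \<and> w - \<omega> v \<in> g_perp B ?P}"
      unfolding K by force
  qed
qed

section \<open>Charts and changes of coordinates\<close>

text \<open>The change of coordinates from the chart \<open>c\<close> to the chart \<open>d\<close>; it is meaningful only on the
  \<open>c\<close>-coordinates of points in both domains.\<close>

definition transition :: "('m, 'e) chart \<Rightarrow> ('m, 'e) chart \<Rightarrow> 'e \<Rightarrow> 'e" where
  "transition c d = snd d \<circ> chart_inv c"

text \<open>The differential of the change of coordinates at the point \<open>q\<close> (given as a point of the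
  manifold, not by its coordinates). The maps \<open>to_coord\<close> and \<open>from_coord\<close> are the instances in
  which one of the two charts is the chosen chart at \<open>q\<close>.\<close>

definition dtransition :: "('m, 'e::euclidean_space) chart \<Rightarrow> ('m, 'e) chart \<Rightarrow> 'm \<Rightarrow> 'e \<Rightarrow> 'e" where
  "dtransition c d q = frechet_derivative (transition c d) (at (snd c q))"

lemma to_coord_eq: "to_coord A c q = dtransition (chart_at A q) c q"
  by (simp add: to_coord_def dtransition_def transition_def)

lemma from_coord_eq: "from_coord A c q = dtransition c (chart_at A q) q"
  by (simp add: from_coord_def dtransition_def transition_def)

text \<open>A smooth manifold, given by its maximal smooth atlas.\<close>

locale smooth_manifold =
  fixes A :: "('m::{t2_space, second_countable_topology}, 'e::euclidean_space) chart set"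
  assumes smooth_struct: "smooth_structure A"
begin

lemma is_chart: "c \<in> A \<Longrightarrow> is_chart c"
  using smooth_struct by (simp add: smooth_structure_def)

lemma open_dom: "c \<in> A \<Longrightarrow> open (fst c)"
  and open_img: "c \<in> A \<Longrightarrow> open (snd c ` fst c)"
  and homeo: "c \<in> A \<Longrightarrow> homeomorphism (fst c) (snd c ` fst c) (snd c) (chart_inv c)"
  using is_chart by (auto simp: is_chart_def)

lemma chart_inv_chart [simp]: "c \<in> A \<Longrightarrow> q \<in> fst c \<Longrightarrow> chart_inv c (snd c q) = q"
  using homeo homeomorphism_apply1 by blast

lemma chart_chart_inv [simp]: "c \<in> A \<Longrightarrow> x \<in> snd c ` fst c \<Longrightarrow> snd c (chart_inv c x) = x"
  by auto

lemma chart_inv_in: "c \<in> A \<Longrightarrow> x \<in> snd c ` fst c \<Longrightarrow> chart_inv c x \<in> fst c"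
  by auto

lemma continuous_on_chart: "c \<in> A \<Longrightarrow> continuous_on (fst c) (snd c)"
  using homeo homeomorphism_cont1 by blast

lemma continuous_on_chart_inv: "c \<in> A \<Longrightarrow> continuous_on (snd c ` fst c) (chart_inv c)"
  using homeo homeomorphism_cont2 by blast

lemma open_img_Int:
  assumes "c \<in> A" "open W" shows "open (snd c ` (fst c \<inter> W))"
proof -
  have "openin (top_of_set (snd c ` fst c)) (snd c ` (fst c \<inter> W))"
    using homeomorphism_imp_open_map[OF homeo[OF assms(1)], of "fst c \<inter> W"] assms(2)
    by (auto simp: openin_open)
  then show ?thesis using open_img[OF assms(1)] openin_open_trans by blast
qed

lemma chart_at: "chart_at A q \<in> A" "q \<in> fst (chart_at A q)"
proof -
  have "\<exists>c. c \<in> A \<and> q \<in> fst c"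
    using smooth_struct unfolding smooth_structure_def by blast
  then have "chart_at A q \<in> A \<and> q \<in> fst (chart_at A q)"
    unfolding chart_at_def by (rule someI_ex)
  then show "chart_at A q \<in> A" "q \<in> fst (chart_at A q)" by auto
qed

lemma smooth_on_transition:
  assumes "c \<in> A" "d \<in> A"
  shows "smooth_on (transition c d) (snd c ` (fst c \<inter> fst d))"
  using assms smooth_struct unfolding smooth_structure_def smooth_compatible_def transition_def by blast

lemma transition_chart: "c \<in> A \<Longrightarrow> q \<in> fst c \<Longrightarrow> transition c d (snd c q) = snd d q"
  by (simp add: transition_def)

lemma transition_has_derivative:
  assumes "c \<in> A" "d \<in> A" "q \<in> fst c" "q \<in> fst d"
  shows "(transition c d has_derivative dtransition c d q) (at (snd c q))"
  unfolding dtransition_def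
  by (rule smooth_on_has_derivative[OF smooth_on_transition[OF assms(1,2)]]) (use assms in auto)

lemma linear_dtransition:
  assumes "c \<in> A" "d \<in> A" "q \<in> fst c" "q \<in> fst d"
  shows "linear (dtransition c d q)"
  using has_derivative_linear[OF transition_has_derivative[OF assms]] .

text \<open>The differential may be computed from any map that agrees with the change of coordinates near the
  point.\<close>

lemma dtransition_eqI:
  assumes "c \<in> A" "d \<in> A" "q \<in> fst c" "q \<in> fst d"
    and "open U" "snd c q \<in> U" "\<And>x. x \<in> U \<Longrightarrow> x \<in> snd c ` fst c \<Longrightarrow> f x = transition c d x"
    and "(f has_derivative D) (at (snd c q))"
  shows "dtransition c d q = D"
proof -
  have "(transition c d has_derivative D) (at (snd c q))"
    by (rule has_derivative_transform_within_open[OF assms(8), of "U \<inter> snd c ` fst c"])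
       (use assms open_img in auto)
  then show ?thesis
    using transition_has_derivative[OF assms(1-4)] has_derivative_unique by blast
qed

lemma dtransition_compose:
  assumes "c \<in> A" "d \<in> A" "e \<in> A" "q \<in> fst c" "q \<in> fst d" "q \<in> fst e"
  shows "dtransition d e q (dtransition c d q v) = dtransition c e q v"
proof -
  have "dtransition c e q = dtransition d e q \<circ> dtransition c d q"
  proof (rule dtransition_eqI[where f = "transition d e \<circ> transition c d"
        and U = "snd c ` (fst c \<inter> fst d)"])
    show "((transition d e \<circ> transition c d) has_derivative
        (dtransition d e q \<circ> dtransition c d q)) (at (snd c q))"
      using transition_has_derivative[of c d q] transition_has_derivative[of d e q] assms
      by (intro diff_chain_at) (auto simp: transition_chart)
    show "open (snd c ` (fst c \<inter> fst d))" using assms open_img_Int open_dom by blast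
    show "(transition d e \<circ> transition c d) x = transition c e x"
      if "x \<in> snd c ` (fst c \<inter> fst d)" for x
      using that assms by (auto simp: transition_def)
  qed (use assms in auto)
  then show ?thesis by simp
qed

lemma dtransition_refl:
  assumes "c \<in> A" "q \<in> fst c"
  shows "dtransition c c q v = v"
proof -
  have "dtransition c c q = (\<lambda>v. v)"
    by (rule dtransition_eqI[where f = "\<lambda>x. x" and U = UNIV])
       (use assms in \<open>auto simp: transition_chart\<close>)
  then show ?thesis by simp
qed

lemma dtransition_inverse:
  assumes "c \<in> A" "d \<in> A" "q \<in> fst c" "q \<in> fst d"
  shows "dtransition d c q (dtransition c d q v) = v"
  using dtransition_compose[of c d c q v] dtransition_refl assms by auto

lemma chart_curve_continuous_nbhd:
  fixes \<sigma> :: "real \<Rightarrow> 'm"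
  assumes "continuous_on I \<sigma>" "t \<in> I" "c \<in> A" "\<sigma> t \<in> fst c"
  obtains \<delta> where "\<delta> > 0" "\<And>s. s \<in> I \<Longrightarrow> dist s t < \<delta> \<Longrightarrow> \<sigma> s \<in> fst c"
proof -
  obtain T where T: "open T" "T \<inter> I = \<sigma> -` fst c \<inter> I"
    using assms(1) open_dom[OF assms(3)] unfolding continuous_on_open_invariant by blast
  then have "t \<in> T" using assms by auto
  then obtain \<delta> where "\<delta> > 0" "ball t \<delta> \<subseteq> T" using T(1) open_contains_ball by blast
  then show thesis using T(2) that by (force simp: dist_commute)
qed

lemma vector_derivative_change_chart:
  fixes \<sigma> :: "real \<Rightarrow> 'm"
  assumes "continuous_on I \<sigma>" "t \<in> I" "c \<in> A" "d \<in> A" "\<sigma> t \<in> fst c" "\<sigma> t \<in> fst d"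
    and "((snd c \<circ> \<sigma>) has_vector_derivative w) (at t within I)"
  shows "((snd d \<circ> \<sigma>) has_vector_derivative dtransition c d (\<sigma> t) w) (at t within I)"
proof -
  obtain \<delta> where \<delta>: "\<delta> > 0" "\<And>s. s \<in> I \<Longrightarrow> dist s t < \<delta> \<Longrightarrow> \<sigma> s \<in> fst c"
    using chart_curve_continuous_nbhd[OF assms(1,2,3,5)] by blast
  have "(transition c d has_derivative dtransition c d (\<sigma> t)) (at ((snd c \<circ> \<sigma>) t))"
    using transition_has_derivative[of c d "\<sigma> t"] assms by simp
  then have "(transition c d has_derivative dtransition c d (\<sigma> t))
      (at ((snd c \<circ> \<sigma>) t) within (snd c \<circ> \<sigma>) ` I)"
    by (rule has_derivative_at_withinI)
  with assms(7) have "(transition c d \<circ> (snd c \<circ> \<sigma>) has_derivative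
      dtransition c d (\<sigma> t) \<circ> (\<lambda>x. x *\<^sub>R w)) (at t within I)"
    unfolding has_vector_derivative_def by (rule diff_chain_within)
  moreover have "dtransition c d (\<sigma> t) \<circ> (\<lambda>x. x *\<^sub>R w) = (\<lambda>x. x *\<^sub>R dtransition c d (\<sigma> t) w)"
    using linear_scale[OF linear_dtransition[of c d "\<sigma> t"]] assms by auto
  ultimately have "(transition c d \<circ> (snd c \<circ> \<sigma>) has_derivative
      (\<lambda>x. x *\<^sub>R dtransition c d (\<sigma> t) w)) (at t within I)"
    by simp
  then show ?thesis
    unfolding has_vector_derivative_def
    by (rule has_derivative_transform_within[OF _ \<delta>(1) assms(2)])
       (use \<delta>(2) assms in \<open>auto simp: transition_chart\<close>)
qed

lemma smooth_curve_has_vector_derivative: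
  assumes "smooth_curve A \<sigma> I" "t \<in> I" "c \<in> A" "\<sigma> t \<in> fst c" "\<not> trivial_limit (at t within I)"
  shows "((snd c \<circ> \<sigma>) has_vector_derivative dtransition (chart_at A (\<sigma> t)) c (\<sigma> t) (velocity A \<sigma> I t))
           (at t within I)"
proof -
  let ?e = "chart_at A (\<sigma> t)"
  obtain d where "d 0 = snd ?e \<circ> \<sigma>" "\<forall>n. \<forall>t\<in>I. \<sigma> t \<in> fst ?e \<longrightarrow>
           (d n has_vector_derivative d (Suc n) t) (at t within I)"
    using assms(1) chart_at(1)[of "\<sigma> t"] unfolding smooth_curve_def by meson
  then have "((snd ?e \<circ> \<sigma>) has_vector_derivative d 1 t) (at t within I)"
    using assms(2) chart_at(2)[of "\<sigma> t"] by (metis One_nat_def)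
  moreover from this have "velocity A \<sigma> I t = d 1 t"
    unfolding velocity_def using assms(5) by (intro vector_derivative_within)
  ultimately show ?thesis
    using assms chart_at vector_derivative_change_chart[of I \<sigma> t ?e c]
    unfolding smooth_curve_def by auto
qed

text \<open>The velocity is by definition computed in the chosen chart at the point; any other chart around
  the point serves as well.\<close>

lemma velocity_eqI:
  assumes "continuous_on I \<sigma>" "t \<in> I" "c \<in> A" "\<sigma> t \<in> fst c" "\<not> trivial_limit (at t within I)"
    and "((snd c \<circ> \<sigma>) has_vector_derivative w) (at t within I)"
  shows "velocity A \<sigma> I t = dtransition c (chart_at A (\<sigma> t)) (\<sigma> t) w"
  unfolding velocity_def
  by (rule vector_derivative_within[OF assms(5)], rule vector_derivative_change_chart)
     (use assms chart_at in auto)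

end

section \<open>Tangent spaces of slices\<close>

context smooth_manifold
begin

text \<open>Straight lines in a chart supply enough smooth curves to realise all the tangent vectors of a
  slice.\<close>

lemma coordinate_line_smooth_curve:
  fixes u :: 'e
  assumes "d \<in> A" "\<And>t. t \<in> I \<Longrightarrow> x + t *\<^sub>R u \<in> snd d ` fst d"
  shows "smooth_curve A (\<lambda>t. chart_inv d (x + t *\<^sub>R u)) I"
  unfolding smooth_curve_def
proof (intro conjI ballI)
  let ?l = "\<lambda>t. x + t *\<^sub>R u" and ?\<sigma> = "\<lambda>t. chart_inv d (x + t *\<^sub>R u)"
  show "continuous_on I ?\<sigma>"
  proof (rule continuous_on_compose2[OF continuous_on_chart_inv[OF assms(1)]])
    show "continuous_on I ?l" by (intro continuous_intros)
  qed (use assms(2) in blast)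
  fix e assume e: "e \<in> A"
  let ?V = "?l -` (snd d ` (fst d \<inter> fst e))"
  have V: "open ?V"
    by (rule open_vimage[OF open_img_Int[OF assms(1) open_dom[OF e]]]) (intro continuous_intros)
  have "smooth_on ?l ?V"
    by (rule smooth_on_affine[OF V]) (rule bounded_linear_scaleR_left)
  then have "smooth_on (transition d e \<circ> ?l) ?V"
    by (intro smooth_on_compose[OF V open_img_Int[OF assms(1) open_dom[OF e]]]
        smooth_on_transition[OF assms(1) e]) auto
  moreover have "snd e \<circ> ?\<sigma> = transition d e \<circ> ?l"
    by (simp add: transition_def o_def)
  ultimately have sm: "smooth_on (snd e \<circ> ?\<sigma>) ?V" by simp
  let ?D = "\<lambda>n. ((\<lambda>h t. frechet_derivative h (at t) 1) ^^ n) (snd e \<circ> ?\<sigma>)"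
  show "\<exists>D. D 0 = snd e \<circ> ?\<sigma> \<and> (\<forall>n. \<forall>t\<in>I. ?\<sigma> t \<in> fst e \<longrightarrow>
      (D n has_vector_derivative D (Suc n) t) (at t within I))"
  proof (intro exI[of _ ?D] conjI allI ballI impI)
    fix n t assume t: "t \<in> I" "?\<sigma> t \<in> fst e"
    have "?\<sigma> t \<in> fst d" "snd d (?\<sigma> t) = ?l t"
      using t(1) assms(2)[OF t(1)] chart_inv_in[OF assms(1)] chart_chart_inv[OF assms(1)] by blast+
    then have "t \<in> ?V" using t(2) by (metis IntI imageI vimageI)
    then have D: "(?D n has_derivative frechet_derivative (?D n) (at t)) (at t)"
      by (rule smooth_on_has_derivative[OF smooth_on_frechet_iterates[OF sm]])
    have "F = (\<lambda>s. s *\<^sub>R F 1)" if "linear F" for F :: "real \<Rightarrow> 'e"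
    proof
      show "F s = s *\<^sub>R F 1" for s using linear_scale[OF that, of s 1] by simp
    qed
    from D this[OF has_derivative_linear[OF D]]
    have "(?D n has_derivative (\<lambda>s. s *\<^sub>R frechet_derivative (?D n) (at t) 1)) (at t)"
      by (rule has_derivative_eq_rhs)
    then have "(?D n has_vector_derivative ?D (Suc n) t) (at t)"
      unfolding has_vector_derivative_def by (simp only: funpow.simps o_apply)
    then show "(?D n has_vector_derivative ?D (Suc n) t) (at t within I)"
      by (rule has_vector_derivative_at_within)
  qed simp
qed

text \<open>If the chart \<open>d\<close> flattens \<open>P\<close> to the linear subspace \<open>E\<close>, then the vectors tangent to \<open>P\<close> at \<open>q\<close> are those
  with \<open>d\<close>-coordinates in \<open>E\<close>. A curve in \<open>P\<close> has coordinates in \<open>E\<close>, hence also the derivative lies in \<open>E\<close>;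
  conversely a coordinate line in a direction of \<open>E\<close> stays in \<open>P\<close>.\<close>

lemma tangent_space_slice:
  assumes "d \<in> A" "subspace E" and slice: "snd d ` (fst d \<inter> P) = snd d ` fst d \<inter> E"
    and q: "q \<in> P" "q \<in> fst d"
  shows "tangent_space A P q = from_coord A d q ` E"
proof (intro equalityI subsetI)
  fix w assume "w \<in> tangent_space A P q"
  then obtain \<sigma> \<epsilon> where *: "\<epsilon> > 0" "smooth_curve A \<sigma> {-\<epsilon>..\<epsilon>}" "\<sigma> ` {-\<epsilon>..\<epsilon>} \<subseteq> P"
      "\<sigma> 0 = q" "w = velocity A \<sigma> {-\<epsilon>..\<epsilon>} 0"
    unfolding tangent_space_def by blast
  let ?I = "{-\<epsilon>..\<epsilon>}" and ?u = "dtransition (chart_at A q) d q w"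
  have nt: "\<not> trivial_limit (at 0 within ?I)"
    using *(1) by (simp add: trivial_limit_within islimpt_Icc)
  have D: "((snd d \<circ> \<sigma>) has_vector_derivative ?u) (at 0 within ?I)"
    using smooth_curve_has_vector_derivative[OF *(2) _ assms(1) _ nt] * q by auto
  have cont: "continuous_on ?I \<sigma>" using *(2) smooth_curve_def by blast
  obtain \<delta> where \<delta>: "\<delta> > 0" "\<And>s. s \<in> ?I \<Longrightarrow> dist s 0 < \<delta> \<Longrightarrow> \<sigma> s \<in> fst d"
    by (rule chart_curve_continuous_nbhd[OF cont _ assms(1), of 0]) (use *(1,4) q in auto)
  have "(snd d \<circ> \<sigma>) s \<in> E" if "s \<in> ?I" "dist s 0 < \<delta>" for s
  proof -
    have "\<sigma> s \<in> fst d \<inter> P" using \<delta>(2)[OF that] *(3) that(1) by blast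
    then show ?thesis using slice by auto
  qed
  then have "?u \<in> E"
    using *(1) by (intro has_vector_derivative_in_subspace[OF D _ nt \<delta>(1) _ assms(2)]) auto
  moreover have "w = from_coord A d q ?u"
    unfolding from_coord_eq using dtransition_inverse[of "chart_at A q" d q w] assms chart_at by simp
  ultimately show "w \<in> from_coord A d q ` E" by blast
next
  fix w assume "w \<in> from_coord A d q ` E"
  then obtain u where u: "u \<in> E" "w = from_coord A d q u" by blast
  let ?l = "\<lambda>t. snd d q + t *\<^sub>R u"
  let ?\<sigma> = "\<lambda>t. chart_inv d (?l t)"
  have "open (?l -` (snd d ` fst d))"
    by (rule open_vimage[OF open_img[OF assms(1)]]) (intro continuous_intros)
  moreover have "0 \<in> ?l -` (snd d ` fst d)" using q by auto
  ultimately obtain \<epsilon> where \<epsilon>: "\<epsilon> > 0" "cball 0 \<epsilon> \<subseteq> ?l -` (snd d ` fst d)"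
    using open_contains_cball by blast
  have I: "{-\<epsilon>..\<epsilon>} = cball 0 \<epsilon>" by (simp add: cball_eq_atLeastAtMost)
  have inE: "?l t \<in> E" for t
  proof -
    have "snd d q \<in> E" using q slice by blast
    then show ?thesis using u(1) assms(2) by (simp add: subspace_add subspace_scale)
  qed
  have l: "?l t \<in> snd d ` (fst d \<inter> P)" if "t \<in> {-\<epsilon>..\<epsilon>}" for t
    using that I \<epsilon>(2) inE slice by blast
  have "?\<sigma> ` {-\<epsilon>..\<epsilon>} \<subseteq> P"
  proof clarify
    fix t assume "t \<in> {-\<epsilon>..\<epsilon>}"
    then obtain r where "r \<in> fst d \<inter> P" "?l t = snd d r" using l by blast
    then show "?\<sigma> t \<in> P" using assms(1) by simp
  qed
  moreover have sm: "smooth_curve A ?\<sigma> {-\<epsilon>..\<epsilon>}"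
    by (rule coordinate_line_smooth_curve[OF assms(1)]) (use l in blast)
  moreover have "velocity A ?\<sigma> {-\<epsilon>..\<epsilon>} 0 = dtransition d (chart_at A (?\<sigma> 0)) (?\<sigma> 0) u"
  proof (rule velocity_eqI)
    show "((snd d \<circ> ?\<sigma>) has_vector_derivative u) (at 0 within {-\<epsilon>..\<epsilon>})"
    proof (rule has_vector_derivative_transform[of 0 _ _ ?l])
      show "(?l has_vector_derivative u) (at 0 within {-\<epsilon>..\<epsilon>})"
        by (auto intro!: derivative_eq_intros)
      show "(snd d \<circ> ?\<sigma>) t = ?l t" if "t \<in> {-\<epsilon>..\<epsilon>}" for t
        using l[OF that] chart_chart_inv[OF assms(1), of "?l t"] unfolding o_def by blast
    qed (use \<epsilon> in auto)
    show "\<not> trivial_limit (at 0 within {-\<epsilon>..\<epsilon>})"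
      using \<epsilon>(1) by (simp add: trivial_limit_within islimpt_Icc)
  qed (use \<epsilon>(1) sm assms q in \<open>auto simp: smooth_curve_def\<close>)
  ultimately show "w \<in> tangent_space A P q"
    unfolding tangent_space_def using \<epsilon>(1) u(2) assms(1) q
    by (intro CollectI exI[of _ ?\<sigma>] exI[of _ \<epsilon>] conjI) (simp_all add: from_coord_eq)
qed

lemma coordinate_field_coord:
  assumes "d \<in> A" "e \<in> A" "q \<in> fst d" "q \<in> fst e"
  shows "field_coord A e (\<lambda>q. from_coord A d q v) (snd e q) = dtransition d e q v"
  using assms chart_at by (simp add: field_coord_def to_coord_eq from_coord_eq dtransition_compose)

text \<open>The coordinate field \<open>q \<mapsto> from_coord A d q v\<close> has the constant \<open>d\<close>-coordinates \<open>v\<close>.\<close>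

lemma smooth_coordinate_field:
  assumes "d \<in> A" shows "smooth_field_on A (\<lambda>q. from_coord A d q v) (fst d)"
  unfolding smooth_field_on_def
proof
  fix e assume e: "e \<in> A"
  let ?F = "\<lambda>y. frechet_derivative (transition d e) (at y) v"
  have "smooth_on ?F (snd d ` (fst d \<inter> fst e))"
    by (intro smooth_on_derivative smooth_on_transition assms e)
  then have "smooth_on (?F \<circ> transition e d) (snd e ` (fst e \<inter> fst d))"
    using assms e open_img_Int open_dom smooth_on_transition
    by (intro smooth_on_compose[of _ "snd d ` (fst d \<inter> fst e)"]) (auto simp: transition_chart)
  moreover have "field_coord A e (\<lambda>q. from_coord A d q v) x = (?F \<circ> transition e d) x"
    if "x \<in> snd e ` (fst e \<inter> fst d)" for x
    using that assms e coordinate_field_coord[of d e _ v]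
    by (auto simp: dtransition_def transition_chart)
  ultimately show "smooth_on (field_coord A e (\<lambda>q. from_coord A d q v)) (snd e ` (fst e \<inter> fst d))"
    using smooth_on_cong[OF open_img_Int[OF e open_dom[OF assms]]] by (metis (no_types, lifting))
qed

text \<open>Coordinate fields extend the vectors tangent to a slice. Without such extensions the
  condition that defines the shape operator would not determine it.\<close>

lemma tangent_extension_coordinate_field:
  assumes "d \<in> A" "subspace E" "snd d ` (fst d \<inter> P) = snd d ` fst d \<inter> E"
    and "p \<in> fst d" "v \<in> E"
  shows "tangent_extension A P p (from_coord A d p v) (\<lambda>q. from_coord A d q v)"
  unfolding tangent_extension_def
proof (intro conjI refl exI[of _ "fst d"] ballI)
  fix q assume "q \<in> P \<inter> fst d"
  then show "from_coord A d q v \<in> tangent_space A P q"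
    using tangent_space_slice[OF assms(1,2,3), of q] assms(5) by simp
qed (use assms open_dom smooth_coordinate_field in auto)

end

section \<open>The metric and its Christoffel symbols\<close>

text \<open>A semi-Riemannian manifold: the metric is nondegenerate, but need not be definite.\<close>

locale semi_riemannian_manifold = smooth_manifold A
  for A :: "('m::{t2_space, second_countable_topology}, 'e::euclidean_space) chart set" +
  fixes g :: "'m \<Rightarrow> 'e \<Rightarrow> 'e \<Rightarrow> real"
  assumes metric: "semi_riemannian_metric A g"
begin

lemma metric_bilinear: "bilinear (g p)"
  and metric_sym: "g p v w = g p w v"
  and metric_nondegenerate: "nondegenerate_on (g p) UNIV"
  and smooth_metric_coord: "c \<in> A \<Longrightarrow> smooth_on (\<lambda>x. metric_coord A g c x u v) (snd c ` fst c)"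
  using metric unfolding semi_riemannian_metric_def by blast+

lemma metric_coord_chart:
  assumes "c \<in> A" "q \<in> fst c"
  shows "metric_coord A g c (snd c q) u v = g q (from_coord A c q u) (from_coord A c q v)"
  using assms by (simp add: metric_coord_def)

lemma metric_coord_sym: "metric_coord A g c x u v = metric_coord A g c x v u"
  by (simp add: metric_coord_def metric_sym)

lemma metric_coord_bilinear:
  assumes "c \<in> A" "x \<in> snd c ` fst c"
  shows "bilinear (metric_coord A g c x)"
proof -
  obtain q where q: "q \<in> fst c" "x = snd c q" using assms by blast
  have lin: "linear (from_coord A c q)"
    unfolding from_coord_eq using linear_dtransition[of c "chart_at A q" q] assms q chart_at by blast
  show ?thesis
    unfolding bilinear_def q(2) metric_coord_chart[OF assms(1) q(1)]
    using metric_bilinear[of q] lin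
    by (auto intro!: linearI simp: linear_add linear_scale bilinear_ladd bilinear_radd
        bilinear_lmul bilinear_rmul)
qed

lemma metric_coord_nondegenerate:
  assumes "c \<in> A" "x \<in> snd c ` fst c"
  shows "nondegenerate_on (metric_coord A g c x) UNIV"
  unfolding nondegenerate_on_def
proof (intro ballI impI)
  fix v assume v: "\<forall>w\<in>UNIV. metric_coord A g c x v w = 0"
  obtain q where q: "q \<in> fst c" "x = snd c q" using assms by blast
  have inv: "from_coord A c q (to_coord A c q w) = w" "to_coord A c q (from_coord A c q w) = w" for w
    using assms q chart_at dtransition_inverse by (simp_all add: from_coord_eq to_coord_eq)
  have "g q (from_coord A c q v) w = 0" for w
    using v q metric_coord_chart[OF assms(1) q(1), of v "to_coord A c q w"] inv(1)[of w] by simp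
  then have "from_coord A c q v = 0"
    using metric_nondegenerate[of q] by (auto simp: nondegenerate_on_def)
  moreover have "linear (to_coord A c q)"
    unfolding to_coord_eq using linear_dtransition[of "chart_at A q" c q] assms q chart_at by blast
  ultimately show "v = 0" using inv(2)[of v] linear_0 by metis
qed

text \<open>The derivative in the direction \<open>i\<close> of the component of the metric on the constant coordinate
  fields \<open>j\<close> and \<open>k\<close>.\<close>

definition dmetric :: "('m, 'e) chart \<Rightarrow> 'e \<Rightarrow> 'e \<Rightarrow> 'e \<Rightarrow> 'e \<Rightarrow> real" where
  "dmetric c x i j k = frechet_derivative (\<lambda>y. metric_coord A g c y j k) (at x) i"

lemma dmetric_has_derivative:
  assumes "c \<in> A" "x \<in> snd c ` fst c"
  shows "((\<lambda>y. metric_coord A g c y j k) has_derivative (\<lambda>i. dmetric c x i j k)) (at x)"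
  unfolding dmetric_def by (rule smooth_on_has_derivative[OF smooth_metric_coord]) (use assms in auto)

lemma dmetric_eqI:
  assumes "c \<in> A" "x \<in> snd c ` fst c" "(f has_derivative F) (at x)"
    and "\<And>y. y \<in> snd c ` fst c \<Longrightarrow> f y = metric_coord A g c y j k"
  shows "dmetric c x i j k = F i"
proof -
  have "((\<lambda>y. metric_coord A g c y j k) has_derivative F) (at x)"
    by (rule has_derivative_transform_within_open[OF assms(3) open_img[OF assms(1)] assms(2)])
       (use assms(4) in auto)
  then show ?thesis
    using has_derivative_unique[OF dmetric_has_derivative[OF assms(1,2), of j k]] by metis
qed

lemma dmetric_sym: "dmetric c x i j k = dmetric c x i k j"
  unfolding dmetric_def by (subst metric_coord_sym) simp

lemma dmetric_linear:
  assumes "c \<in> A" "x \<in> snd c ` fst c"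
  shows "linear (\<lambda>i. dmetric c x i j k)" "linear (\<lambda>j. dmetric c x i j k)" "linear (\<lambda>k. dmetric c x i j k)"
proof -
  show "linear (\<lambda>i. dmetric c x i j k)"
    using has_derivative_linear[OF dmetric_has_derivative[OF assms]] .
  note D = dmetric_has_derivative[OF assms]
  show *: "linear (\<lambda>j. dmetric c x i j k)" for k
  proof (rule linearI)
    show "dmetric c x i (j + j') k = dmetric c x i j k + dmetric c x i j' k" for j j'
      by (rule dmetric_eqI[OF assms has_derivative_add[OF D D]])
         (simp add: bilinear_ladd[OF metric_coord_bilinear[OF assms(1)]])
    show "dmetric c x i (r *\<^sub>R j) k = r *\<^sub>R dmetric c x i j k" for r j
      by (rule dmetric_eqI[OF assms has_derivative_scaleR_right[OF D]])
         (simp add: bilinear_lmul[OF metric_coord_bilinear[OF assms(1)]])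
  qed
  show "linear (\<lambda>k. dmetric c x i j k)"
    using *[of j] by (subst dmetric_sym)
qed

text \<open>The Christoffel symbols are defined as the unique solution of the Koszul formula; it exists because
  the right-hand side is linear in \<open>w\<close> and the metric is nondegenerate.\<close>

lemma christoffel_koszul:
  assumes "c \<in> A" "x \<in> snd c ` fst c"
  shows "2 * metric_coord A g c x (christoffel A g c x u v) w
    = dmetric c x u v w + dmetric c x v u w - dmetric c x w u v" (is "_ = ?K w")
proof -
  note L = dmetric_linear[OF assms]
  have "linear (\<lambda>w. ?K w / 2)"
    by (intro linearI)
       (simp_all add: linear_add[OF L(1)] linear_add[OF L(3)] linear_scale[OF L(1)]
         linear_scale[OF L(3)] add_divide_distrib diff_divide_distrib algebra_simps)
  then have "\<exists>!z. \<forall>w. metric_coord A g c x z w = ?K w / 2"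
    using bilinear_form_represents_on[OF metric_coord_bilinear[OF assms] subspace_UNIV
        metric_coord_nondegenerate[OF assms]]
    by (simp only: UNIV_I ball_UNIV simp_thms)
  moreover have "(metric_coord A g c x z w = ?K w / 2) \<longleftrightarrow> (2 * metric_coord A g c x z w = ?K w)" for z w
    by auto
  ultimately have "\<exists>!z. \<forall>w. 2 * metric_coord A g c x z w = ?K w" by (simp only:)
  then have "\<forall>w. 2 * metric_coord A g c x (THE z. \<forall>w. 2 * metric_coord A g c x z w = ?K w) w = ?K w"
    by (rule theI')
  moreover have "christoffel A g c x u v = (THE z. \<forall>w. 2 * metric_coord A g c x z w = ?K w)"
    by (simp add: christoffel_def Let_def dmetric_def)
  ultimately show ?thesis by simp
qed

lemma metric_coord_cancel:
  assumes "c \<in> A" "x \<in> snd c ` fst c" "\<And>w. metric_coord A g c x z w = metric_coord A g c x z' w"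
  shows "z = z'"
proof -
  have "metric_coord A g c x (z - z') w = 0" for w
    using assms(3)[of w] by (simp add: bilinear_lsub[OF metric_coord_bilinear[OF assms(1,2)]])
  then have "z - z' = 0"
    using metric_coord_nondegenerate[OF assms(1,2)] unfolding nondegenerate_on_def by blast
  then show ?thesis by simp
qed

lemma christoffel_sym:
  assumes "c \<in> A" "x \<in> snd c ` fst c"
  shows "christoffel A g c x u v = christoffel A g c x v u"
proof (rule metric_coord_cancel[OF assms])
  fix w
  have "2 * metric_coord A g c x (christoffel A g c x u v) w
      = 2 * metric_coord A g c x (christoffel A g c x v u) w"
    unfolding christoffel_koszul[OF assms] by (simp add: dmetric_sym[of c x w u v])
  then show "metric_coord A g c x (christoffel A g c x u v) w
      = metric_coord A g c x (christoffel A g c x v u) w" by simp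
qed

lemma christoffel_bilinear:
  assumes "c \<in> A" "x \<in> snd c ` fst c"
  shows "bilinear (christoffel A g c x)"
proof -
  note L = dmetric_linear[OF assms]
  note B = metric_coord_bilinear[OF assms]
  note K = christoffel_koszul[OF assms]
  have lin: "linear (christoffel A g c x u)" for u
  proof (rule linearI)
    fix v v'
    show "christoffel A g c x u (v + v') = christoffel A g c x u v + christoffel A g c x u v'"
    proof (rule metric_coord_cancel[OF assms])
      fix w
      have "2 * metric_coord A g c x (christoffel A g c x u (v + v')) w =
          2 * metric_coord A g c x (christoffel A g c x u v) w
          + 2 * metric_coord A g c x (christoffel A g c x u v') w"
        unfolding K by (simp add: linear_add[OF L(1)] linear_add[OF L(2)] linear_add[OF L(3)])
      then show "metric_coord A g c x (christoffel A g c x u (v + v')) w =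
          metric_coord A g c x (christoffel A g c x u v + christoffel A g c x u v') w"
        by (simp add: bilinear_ladd[OF B])
    qed
  next
    fix r v
    show "christoffel A g c x u (r *\<^sub>R v) = r *\<^sub>R christoffel A g c x u v"
    proof (rule metric_coord_cancel[OF assms])
      fix w
      have "2 * metric_coord A g c x (christoffel A g c x u (r *\<^sub>R v)) w =
          r * (2 * metric_coord A g c x (christoffel A g c x u v) w)"
        unfolding K by (simp add: linear_scale[OF L(1)] linear_scale[OF L(2)] linear_scale[OF L(3)]
            algebra_simps)
      then show "metric_coord A g c x (christoffel A g c x u (r *\<^sub>R v)) w =
          metric_coord A g c x (r *\<^sub>R christoffel A g c x u v) w"
        by (simp add: bilinear_lmul[OF B])
    qed
  qed
  moreover have "linear (\<lambda>u. christoffel A g c x u v)" for v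
    using lin[of v] by (subst christoffel_sym[OF assms])
  ultimately show ?thesis unfolding bilinear_def by blast
qed

text \<open>Compactness of a closed coordinate ball gives a uniform lower bound for the metric, as a
  nondegenerate form, and an upper bound for its derivatives. The Koszul formula then bounds the
  Christoffel symbols.\<close>

lemma christoffel_bound:
  assumes c: "c \<in> A" and x0: "x0 \<in> snd c ` fst c"
  obtains r C where "r > 0" "C \<ge> 0" "cball x0 r \<subseteq> snd c ` fst c"
    "\<And>x u. x \<in> cball x0 r \<Longrightarrow> norm (christoffel A g c x u u) \<le> C * (norm u)\<^sup>2"
proof -
  let ?G = "metric_coord A g c" and ?D = "dmetric c"
  obtain r where r: "r > 0" and sub: "cball x0 r \<subseteq> snd c ` fst c"
    using open_img[OF c] x0 open_contains_cball by blast
  have contG: "continuous_on (cball x0 r) (\<lambda>x. ?G x u v)" for u v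
    using smooth_on_continuous_on[OF smooth_metric_coord[OF c]] sub continuous_on_subset by blast
  have contD: "continuous_on (cball x0 r) (\<lambda>x. ?D x i j k)" for i j k
    unfolding dmetric_def
    using smooth_on_continuous_on[OF smooth_on_derivative[OF smooth_metric_coord[OF c]]]
      sub continuous_on_subset by blast
  have G_expand: "?G x z b = (\<Sum>i\<in>Basis. (z \<bullet> i) * ?G x i b)" if "x \<in> cball x0 r" for x z b
  proof -
    have "linear (\<lambda>z. ?G x z b)"
      using metric_coord_bilinear[OF c, of x] that sub unfolding bilinear_def by blast
    then show ?thesis using linear_expand_Basis[of "\<lambda>z. ?G x z b" z] by simp
  qed
  \<comment> \<open>Uniform nondegeneracy: the squared length of the covector \<open>?G x z\<close> has a positive minimum
    \<open>\<mu>\<close> over the compact set of pairs of a point of the ball and a unit vector \<open>z\<close>.\<close>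
  let ?Q = "\<lambda>x z. \<Sum>b\<in>Basis. (?G x z b)\<^sup>2"
  define K where "K = cball x0 r \<times> sphere (0::'e) 1"
  have "continuous_on K (\<lambda>(x, z). \<Sum>b\<in>Basis. (\<Sum>i\<in>Basis. (z \<bullet> i) * ?G x i b)\<^sup>2)"
    unfolding K_def case_prod_beta
    by (intro continuous_intros continuous_on_compose2[OF contG]) auto
  moreover have "(case xz of (x, z) \<Rightarrow> \<Sum>b\<in>Basis. (\<Sum>i\<in>Basis. (z \<bullet> i) * ?G x i b)\<^sup>2) =
      (case xz of (x, z) \<Rightarrow> ?Q x z)" if "xz \<in> K" for xz
    using that G_expand by (auto simp: K_def)
  ultimately have "continuous_on K (\<lambda>(x, z). ?Q x z)"
    by (rule continuous_on_eq)
  moreover have "compact K" "K \<noteq> {}"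
    unfolding K_def using r by (auto intro: compact_Times)
  ultimately obtain x1 z1 where min: "(x1, z1) \<in> K" "\<And>x z. (x, z) \<in> K \<Longrightarrow> ?Q x1 z1 \<le> ?Q x z"
    using continuous_attains_inf[of K "\<lambda>(x, z). ?Q x z"] by fast
  define \<mu> where "\<mu> = ?Q x1 z1"
  have "\<mu> \<noteq> 0"
  proof
    assume "\<mu> = 0"
    then have "\<forall>b\<in>Basis. ?G x1 z1 b = 0"
      unfolding \<mu>_def by (subst (asm) sum_nonneg_eq_0_iff) auto
    moreover have x1: "x1 \<in> snd c ` fst c" using min(1) sub by (auto simp: K_def)
    then have "linear (?G x1 z1)" using metric_coord_bilinear[OF c] bilinear_def by blast
    ultimately have "?G x1 z1 w = 0" for w
      using linear_expand_Basis[of "?G x1 z1" w] by simp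
    then have "z1 = 0"
      using metric_coord_nondegenerate[OF c x1] unfolding nondegenerate_on_def by blast
    then show False using min(1) by (simp add: K_def)
  qed
  moreover have "\<mu> \<ge> 0" unfolding \<mu>_def by (intro sum_nonneg) auto
  ultimately have \<mu>: "\<mu> > 0" by simp
  have Q_ge: "\<mu> * (norm z)\<^sup>2 \<le> ?Q x z" if x: "x \<in> cball x0 r" for x z
  proof (cases "z = 0")
    case False
    have B: "bilinear (?G x)" using metric_coord_bilinear[OF c] x sub by blast
    have "\<mu> \<le> ?Q x (z /\<^sub>R norm z)"
      unfolding \<mu>_def using False x by (intro min(2)) (auto simp: K_def)
    also have "\<dots> = ?Q x z / (norm z)\<^sup>2"
      by (simp add: bilinear_lmul[OF B] power_mult_distrib power_inverse divide_inverse
          sum_distrib_left mult.commute)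
    finally show ?thesis using False by (simp add: field_simps)
  qed (auto intro: sum_nonneg)
  \<comment> \<open>On the diagonal the Koszul expression is at most \<open>(norm u)\<^sup>2\<close> times \<open>?H\<close>, which is continuous
    and hence bounded on the ball.\<close>
  let ?H = "\<lambda>x b. \<Sum>i\<in>Basis. \<Sum>j\<in>Basis. \<bar>2 * ?D x i j b - ?D x b i j\<bar>"
  let ?T = "\<lambda>x. \<Sum>b\<in>Basis. (?H x b)\<^sup>2"
  have contT: "continuous_on (cball x0 r) ?T"
    by (intro continuous_intros contD)
  have "\<exists>y\<in>cball x0 r. \<forall>x\<in>cball x0 r. ?T x \<le> ?T y"
    by (rule continuous_attains_sup[OF compact_cball _ contT]) (use r in simp)
  then obtain M where M: "\<And>x. x \<in> cball x0 r \<Longrightarrow> ?T x \<le> M"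
    by blast
  have "0 \<le> ?T x0" by (intro sum_nonneg) auto
  also have "\<dots> \<le> M" using M r by simp
  finally have "M \<ge> 0" .
  have K_le: "\<bar>2 * ?D x u u b - ?D x b u u\<bar> \<le> (norm u)\<^sup>2 * ?H x b" if x: "x \<in> cball x0 r" for x u b
  proof -
    note L = dmetric_linear[OF c, of x]
    have xi: "x \<in> snd c ` fst c" using x sub by blast
    have 1: "?D x u u b = (\<Sum>i\<in>Basis. \<Sum>j\<in>Basis. (u \<bullet> i) * (u \<bullet> j) * ?D x i j b)"
      by (subst linear_expand_Basis[OF L(1)[OF xi]], subst linear_expand_Basis[OF L(2)[OF xi], of _ u])
         (simp add: sum_distrib_left mult.assoc)
    have 2: "?D x b u u = (\<Sum>i\<in>Basis. \<Sum>j\<in>Basis. (u \<bullet> i) * (u \<bullet> j) * ?D x b i j)"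
      by (subst linear_expand_Basis[OF L(2)[OF xi]], subst linear_expand_Basis[OF L(3)[OF xi], of _ _ u])
         (simp add: sum_distrib_left mult.assoc)
    have 3: "2 * ?D x u u b - ?D x b u u =
        (\<Sum>i\<in>Basis. \<Sum>j\<in>Basis. (u \<bullet> i) * (u \<bullet> j) * (2 * ?D x i j b - ?D x b i j))"
      unfolding 1 2 by (simp add: sum_distrib_left sum_subtractf algebra_simps)
    show ?thesis
      unfolding 3 sum_distrib_left
    proof (intro order_trans[OF sum_abs] sum_mono)
      fix i j :: 'e assume "i \<in> Basis" "j \<in> Basis"
      then have "\<bar>u \<bullet> i\<bar> * \<bar>u \<bullet> j\<bar> \<le> norm u * norm u"
        using Basis_le_norm by (intro mult_mono) auto
      then show "\<bar>u \<bullet> i * (u \<bullet> j) * (2 * ?D x i j b - ?D x b i j)\<bar>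
          \<le> (norm u)\<^sup>2 * \<bar>2 * ?D x i j b - ?D x b i j\<bar>"
        unfolding abs_mult power2_eq_square by (rule mult_right_mono) simp
    qed
  qed
  show thesis
  proof (rule that[of r "sqrt (M / (4 * \<mu>))"])
    fix x u assume x: "x \<in> cball x0 r"
    let ?z = "christoffel A g c x u u"
    have "x \<in> snd c ` fst c" using x sub by blast
    then have 2: "2 * ?G x ?z b = 2 * ?D x u u b - ?D x b u u" for b
      using christoffel_koszul[OF c] by simp
    have "4 * \<mu> * (norm ?z)\<^sup>2 \<le> 4 * ?Q x ?z"
      using Q_ge[OF x, of ?z] by simp
    also have "\<dots> = (\<Sum>b\<in>Basis. (2 * ?G x ?z b)\<^sup>2)"
      by (simp add: sum_distrib_left power_mult_distrib)
    also have "\<dots> \<le> (\<Sum>b\<in>Basis. ((norm u)\<^sup>2 * ?H x b)\<^sup>2)"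
      unfolding 2 using K_le[OF x, of u] by (intro sum_mono power2_le_iff_abs_le[THEN iffD2])
        (auto intro!: mult_nonneg_nonneg sum_nonneg)
    also have "\<dots> = ((norm u)\<^sup>2)\<^sup>2 * ?T x"
      unfolding power_mult_distrib by (rule sum_distrib_left[symmetric])
    also have "\<dots> \<le> ((norm u)\<^sup>2)\<^sup>2 * M"
      using M[OF x] by (intro mult_left_mono) auto
    finally have "(norm ?z)\<^sup>2 \<le> M / (4 * \<mu>) * ((norm u)\<^sup>2)\<^sup>2"
      using \<mu> by (simp add: field_simps)
    then have "sqrt ((norm ?z)\<^sup>2) \<le> sqrt (M / (4 * \<mu>) * ((norm u)\<^sup>2)\<^sup>2)"
      by (rule real_sqrt_le_mono)
    then show "norm ?z \<le> sqrt (M / (4 * \<mu>)) * (norm u)\<^sup>2"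
      by (simp only: real_sqrt_mult real_sqrt_abs abs_norm_cancel abs_power2)
  qed (use r \<mu> \<open>M \<ge> 0\<close> sub in auto)
qed

end

section \<open>Geodesics with a zero velocity\<close>

context semi_riemannian_manifold
begin

text \<open>Every time \<open>t0\<close> has a neighbourhood in which a velocity that vanishes at one time vanishes at
  all times, and then the geodesic is constant there.\<close>

lemma geodesic_locally_constant:
  assumes "geodesic A g \<gamma> a b" "a < b" "t0 \<in> {a..b}"
  obtains \<delta> where "\<delta> > 0"
    "\<And>s t. s \<in> {a..b} \<Longrightarrow> t \<in> {a..b} \<Longrightarrow> dist s t0 < \<delta> \<Longrightarrow> dist t t0 < \<delta> \<Longrightarrow>
      velocity A \<gamma> {a..b} s = 0 \<Longrightarrow> velocity A \<gamma> {a..b} t = 0 \<and> \<gamma> t = \<gamma> s"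
proof -
  let ?I = "{a..b}"
  define c where "c = chart_at A (\<gamma> t0)"
  have c: "c \<in> A" "\<gamma> t0 \<in> fst c" using chart_at by (auto simp: c_def)
  have sm: "smooth_curve A \<gamma> ?I" using assms(1) geodesic_def by blast
  then have cont: "continuous_on ?I \<gamma>" using smooth_curve_def by blast
  obtain d where d: "d 0 = snd c \<circ> \<gamma>" "\<And>n t. t \<in> ?I \<Longrightarrow> \<gamma> t \<in> fst c \<Longrightarrow>
      (d n has_vector_derivative d (Suc n) t) (at t within ?I)"
    using sm c(1) unfolding smooth_curve_def by meson
  have nt: "\<not> trivial_limit (at t within ?I)" if "t \<in> ?I" for t
    using assms(2) that by (simp add: trivial_limit_within islimpt_Icc)
  have near: "\<exists>\<delta>>0. \<forall>s\<in>?I. dist s t0 < \<delta> \<longrightarrow> dist (d n s) (d n t0) < e" if "e > 0" for n e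
    using has_vector_derivative_continuous[OF d(2)[OF assms(3) c(2), of n]] that
    unfolding continuous_within_eps_delta by blast
  obtain r C where rC: "r > 0" "C \<ge> 0" "cball (snd c (\<gamma> t0)) r \<subseteq> snd c ` fst c"
    "\<And>x u. x \<in> cball (snd c (\<gamma> t0)) r \<Longrightarrow> norm (christoffel A g c x u u) \<le> C * (norm u)\<^sup>2"
    using christoffel_bound[OF c(1), of "snd c (\<gamma> t0)"] c(2) by blast
  obtain \<delta>1 where \<delta>1: "\<delta>1 > 0" "\<And>s. s \<in> ?I \<Longrightarrow> dist s t0 < \<delta>1 \<Longrightarrow> \<gamma> s \<in> fst c"
    using chart_curve_continuous_nbhd[OF cont assms(3) c] by blast
  obtain \<delta>2 where \<delta>2: "\<delta>2 > 0" "\<forall>s\<in>?I. dist s t0 < \<delta>2 \<longrightarrow> dist (d 0 s) (d 0 t0) < r"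
    using near[OF rC(1), of 0] by blast
  obtain \<delta>3 where \<delta>3: "\<delta>3 > 0" "\<forall>s\<in>?I. dist s t0 < \<delta>3 \<longrightarrow> dist (d 1 s) (d 1 t0) < 1"
    using near[of 1 1] by auto
  define M where "M = norm (d 1 t0) + 1"
  define k where "k = C * M"
  have k: "k \<ge> 0" using rC(2) by (simp add: k_def M_def)
  \<comment> \<open>The last entry makes \<open>k\<close> times the length \<open>2 * \<delta>\<close> of the interval at most \<open>1 / 2\<close>.\<close>
  define \<delta> where "\<delta> = min (min \<delta>1 \<delta>2) (min \<delta>3 (1 / (4 * (k + 1))))"
  have \<delta>: "\<delta> > 0" "\<delta> \<le> \<delta>1" "\<delta> \<le> \<delta>2" "\<delta> \<le> \<delta>3" "\<delta> \<le> 1 / (4 * (k + 1))"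
    using \<delta>1(1) \<delta>2(1) \<delta>3(1) k by (auto simp: \<delta>_def)
  define J where "J = ?I \<inter> ball t0 \<delta>"
  have J: "convex J" "J \<subseteq> ?I" unfolding J_def by (auto intro: convex_Int)
  have JD: "s \<in> ?I" "dist s t0 < \<delta>" "\<gamma> s \<in> fst c" if "s \<in> J" for s
    using that \<delta>1(2)[of s] \<delta>(2) by (auto simp: J_def dist_commute)
  have d_J: "(d n has_vector_derivative d (Suc n) t) (at t within J)" if "t \<in> J" for n t
    using d(2)[OF JD(1,3)[OF that]] J(2) has_vector_derivative_within_subset by blast
  \<comment> \<open>The velocity refers to the chosen chart at \<open>\<gamma> t\<close>, which varies with \<open>t\<close>; vanishing can be tested
    in the fixed chart \<open>c\<close>.\<close>
  have velo: "d 1 t = dtransition (chart_at A (\<gamma> t)) c (\<gamma> t) (velocity A \<gamma> ?I t)"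
    "velocity A \<gamma> ?I t = dtransition c (chart_at A (\<gamma> t)) (\<gamma> t) (d 1 t)" if "t \<in> J" for t
  proof -
    have D: "((snd c \<circ> \<gamma>) has_vector_derivative d 1 t) (at t within ?I)"
      using d(2)[OF JD(1,3)[OF that], of 0] d(1) by simp
    show "d 1 t = dtransition (chart_at A (\<gamma> t)) c (\<gamma> t) (velocity A \<gamma> ?I t)"
      using vector_derivative_unique_within[OF nt D
        smooth_curve_has_vector_derivative[OF sm _ c(1)]] JD[OF that] nt by blast
    show "velocity A \<gamma> ?I t = dtransition c (chart_at A (\<gamma> t)) (\<gamma> t) (d 1 t)"
      by (rule velocity_eqI[OF cont _ c(1) _ nt D]) (use JD[OF that] in auto)
  qed
  have velo0: "velocity A \<gamma> ?I t = 0 \<longleftrightarrow> d 1 t = 0" if "t \<in> J" for t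
  proof -
    have "linear (dtransition (chart_at A (\<gamma> t)) c (\<gamma> t))" "linear (dtransition c (chart_at A (\<gamma> t)) (\<gamma> t))"
      using linear_dtransition chart_at c(1) JD(3)[OF that] by blast+
    then show ?thesis using velo[OF that] linear_0 by metis
  qed
  have d2: "d 2 t = - christoffel A g c (d 0 t) (d 1 t) (d 1 t)" if t: "t \<in> J" for t
  proof -
    define x' where "x' = (\<lambda>s. vector_derivative (snd c \<circ> \<gamma>) (at s within ?I))"
    have x': "x' s = d 1 s" if "s \<in> ?I" "\<gamma> s \<in> fst c" for s
      unfolding x'_def using d(2)[OF that, of 0] d(1) nt[OF that(1)]
      by (intro vector_derivative_within) auto
    obtain \<epsilon> where \<epsilon>: "\<epsilon> > 0" "\<And>s. s \<in> ?I \<Longrightarrow> dist s t < \<epsilon> \<Longrightarrow> \<gamma> s \<in> fst c"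
      using chart_curve_continuous_nbhd[OF cont JD(1)[OF t] c(1) JD(3)[OF t]] by blast
    have "(x' has_vector_derivative d 2 t) (at t within ?I)"
    proof (rule has_vector_derivative_transform_within[OF _ \<epsilon>(1) JD(1)[OF t]])
      show "(d 1 has_vector_derivative d 2 t) (at t within ?I)"
        using d(2)[OF JD(1,3)[OF t], of 1] by (simp add: numeral_2_eq_2)
      show "d 1 s = x' s" if "s \<in> ?I" "dist s t < \<epsilon>" for s
        using x'[OF that(1) \<epsilon>(2)[OF that]] by simp
    qed
    then have "vector_derivative x' (at t within ?I) = d 2 t"
      using nt[OF JD(1)[OF t]] by (intro vector_derivative_within)
    moreover have "vector_derivative x' (at t within ?I)
        + christoffel A g c ((snd c \<circ> \<gamma>) t) (x' t) (x' t) = 0"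
      using assms(1) c(1) JD(1,3)[OF t] unfolding geodesic_def Let_def x'_def by blast
    ultimately show ?thesis
      using x'[OF JD(1,3)[OF t]] d(1) by (simp add: eq_neg_iff_add_eq_0)
  qed
  have bd1: "norm (d 1 t) \<le> M" if "t \<in> J" for t
  proof -
    have "dist (d 1 t) (d 1 t0) < 1" using \<delta>3(2) JD[OF that] \<delta>(4) by auto
    then show ?thesis
      unfolding M_def dist_norm using norm_triangle_sub[of "d 1 t" "d 1 t0"] by linarith
  qed
  have bd2: "norm (d 2 t) \<le> k * norm (d 1 t)" if t: "t \<in> J" for t
  proof -
    have "dist (d 0 t) (d 0 t0) < r" using \<delta>2(2) JD[OF t] \<delta>(3) by auto
    then have "d 0 t \<in> cball (snd c (\<gamma> t0)) r" using d(1) by (simp add: dist_commute)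
    then have "norm (d 2 t) \<le> C * (norm (d 1 t))\<^sup>2"
      unfolding d2[OF t] norm_minus_cancel by (rule rC(4))
    also have "\<dots> \<le> C * (M * norm (d 1 t))"
      unfolding power2_eq_square using bd1[OF t] rC(2) by (intro mult_left_mono mult_right_mono) auto
    finally show ?thesis by (simp add: k_def mult.assoc)
  qed
  show thesis
  proof (rule that[OF \<delta>(1)])
    fix s t assume "s \<in> ?I" "t \<in> ?I" "dist s t0 < \<delta>" "dist t t0 < \<delta>" and v: "velocity A \<gamma> ?I s = 0"
    then have sJ: "s \<in> J" and tJ: "t \<in> J" by (auto simp: J_def dist_commute)
    have zero: "d 1 u = 0" if u: "u \<in> J" for u
    proof (rule zero_if_derivative_small[OF J(1) _ bd1 bd2 k _ sJ _ u])
      show "(d 1 has_vector_derivative d 2 u) (at u within J)" if "u \<in> J" for u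
        using d_J[OF that, of 1] by (simp add: numeral_2_eq_2)
      show "k * \<bar>u - s\<bar> \<le> 1 / 2" if "u \<in> J" for u
      proof -
        have "\<bar>u - s\<bar> \<le> 2 * \<delta>"
          using JD(2)[OF that] JD(2)[OF sJ] by (simp add: dist_real_def)
        also have "\<dots> \<le> 2 * (1 / (4 * (k + 1)))" using \<delta>(5) by simp
        finally have "k * \<bar>u - s\<bar> \<le> k * (2 * (1 / (4 * (k + 1))))"
          using k by (rule mult_left_mono)
        also have "\<dots> \<le> 1 / 2" using k by (simp add: field_simps)
        finally show ?thesis .
      qed
      show "d 1 s = 0" using velo0[OF sJ] v by simp
    qed
    have "norm (d 0 t - d 0 s) \<le> 0 * \<bar>t - s\<bar>"
    proof (rule vector_derivative_mean_value_bound[OF J(1) _ _ sJ tJ])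
      show "(d 0 has_vector_derivative d 1 u) (at u within J)" if "u \<in> J" for u
        using d_J[OF that, of 0] by simp
      show "norm (d 1 u) \<le> 0" if "u \<in> J" for u using zero[OF that] by simp
    qed
    then have "snd c (\<gamma> t) = snd c (\<gamma> s)" using d(1) by simp
    then have "\<gamma> t = \<gamma> s" using chart_inv_chart[OF c(1)] JD(3)[OF sJ] JD(3)[OF tJ] by metis
    then show "velocity A \<gamma> ?I t = 0 \<and> \<gamma> t = \<gamma> s" using velo0[OF tJ] zero[OF tJ] by simp
  qed
qed

lemma nonconstant_geodesic_velocity_nonzero:
  assumes "geodesic A g \<gamma> a b" "a < b" "s \<in> {a..b}" "t \<in> {a..b}" "\<gamma> s \<noteq> \<gamma> t" "u \<in> {a..b}"
  shows "velocity A \<gamma> {a..b} u \<noteq> 0"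
proof
  let ?v = "velocity A \<gamma> {a..b}"
  assume u: "?v u = 0"
  \<comment> \<open>a locally valid equivalence relation on a connected interval, hence valid for all pairs\<close>
  let ?R = "\<lambda>s t. (?v s = 0 \<longleftrightarrow> ?v t = 0) \<and> (?v s = 0 \<longrightarrow> \<gamma> s = \<gamma> t)"
  have R: "?R u t" if "t \<in> {a..b}" for t
  proof (rule connected_equivalence_relation[of "{a..b}" u t ?R])
    fix t0 assume t0: "t0 \<in> {a..b}"
    obtain \<delta> where \<delta>: "\<delta> > 0"
      "\<And>s t. s \<in> {a..b} \<Longrightarrow> t \<in> {a..b} \<Longrightarrow> dist s t0 < \<delta> \<Longrightarrow> dist t t0 < \<delta> \<Longrightarrow>
        ?v s = 0 \<Longrightarrow> ?v t = 0 \<and> \<gamma> t = \<gamma> s"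
      using geodesic_locally_constant[OF assms(1,2) t0] by blast
    show "\<exists>T. openin (top_of_set {a..b}) T \<and> t0 \<in> T \<and> (\<forall>x\<in>T. ?R t0 x)"
    proof (intro exI[of _ "{a..b} \<inter> ball t0 \<delta>"] conjI ballI)
      show "openin (top_of_set {a..b}) ({a..b} \<inter> ball t0 \<delta>)" by (simp add: openin_open_Int)
      show "t0 \<in> {a..b} \<inter> ball t0 \<delta>" using t0 \<delta>(1) by simp
      fix x assume "x \<in> {a..b} \<inter> ball t0 \<delta>"
      then have x: "x \<in> {a..b}" "dist x t0 < \<delta>" by (auto simp: dist_commute)
      have t0': "dist t0 t0 < \<delta>" using \<delta>(1) by simp
      show "?v t0 = 0 \<longleftrightarrow> ?v x = 0"
        using \<delta>(2)[OF t0 x(1) t0' x(2)] \<delta>(2)[OF x(1) t0 x(2) t0'] by blast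
      show "?v t0 = 0 \<longrightarrow> \<gamma> t0 = \<gamma> x"
      proof
        assume "?v t0 = 0"
        from \<delta>(2)[OF t0 x(1) t0' x(2) this] show "\<gamma> t0 = \<gamma> x" by simp
      qed
    qed
  next
    show "?R y x" if "?R x y" for x y using that by metis
    show "?R x z" if "?R x y" "?R y z" for x y z using that by metis
  qed (use that assms(6) in simp_all)
  show False using R[OF assms(3)] R[OF assms(4)] u assms(5) by simp
qed

end

section \<open>Submanifolds with prescribed second fundamental form\<close>

lemma smooth_on_quadratic:
  fixes Q :: "'e::euclidean_space \<Rightarrow> 'e \<Rightarrow> real"
  assumes "bilinear Q" shows "smooth_on (\<lambda>x. Q x x *\<^sub>R m) UNIV"
proof (rule smooth_on_if_derivative)
  fix x :: 'e
  have Q: "bounded_bilinear Q" using assms bilinear_conv_bounded_bilinear by blast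
  show "((\<lambda>x. Q x x *\<^sub>R m) has_derivative (\<lambda>v. (Q x v + Q v x) *\<^sub>R m)) (at x)"
    by (intro has_derivative_scaleR_left bounded_bilinear.FDERIV[OF Q] has_derivative_ident)
next
  fix v
  have "linear (\<lambda>x. (Q x v + Q v x) *\<^sub>R m)"
    by (intro linearI) (simp_all add: assms bilinear_ladd bilinear_radd bilinear_lmul bilinear_rmul
        algebra_simps)
  then show "smooth_on (\<lambda>x. (Q x v + Q v x) *\<^sub>R m) UNIV"
    using smooth_on_affine[of UNIV _ 0] linear_conv_bounded_linear by (auto simp only: open_UNIV add_0)
qed simp

context smooth_manifold
begin

text \<open>By maximality of the atlas, a chart composed with a diffeomorphism of the model space is again a
  chart of the atlas.\<close>

lemma diffeomorphic_chart:
  assumes c: "c \<in> A"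
    and \<psi>: "smooth_on \<psi> UNIV" and \<phi>: "smooth_on \<phi> UNIV"
    and inv: "\<And>x. \<phi> (\<psi> x) = x" "\<And>z. \<psi> (\<phi> z) = z"
  shows "(fst c, \<psi> \<circ> snd c) \<in> A"
proof -
  let ?d = "(fst c, \<psi> \<circ> snd c)"
  have cont: "continuous_on X \<psi>" "continuous_on X \<phi>" for X
    using smooth_on_continuous_on[OF \<psi>] smooth_on_continuous_on[OF \<phi>] continuous_on_subset by blast+
  have dinv: "chart_inv ?d z = chart_inv c (\<phi> z)" if z: "z \<in> (\<psi> \<circ> snd c) ` fst c" for z
  proof -
    obtain q where q: "q \<in> fst c" "z = \<psi> (snd c q)" using z by auto
    have "inj_on (\<psi> \<circ> snd c) (fst c)"
      by (rule inj_on_inverseI[of _ "chart_inv c \<circ> \<phi>"]) (simp add: c inv)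
    then have "chart_inv ?d z = q"
      unfolding chart_inv_def using q inv_into_f_f[of "\<psi> \<circ> snd c" "fst c" q] by simp
    then show ?thesis using q c inv(1) by simp
  qed
  have img: "(\<psi> \<circ> snd c) ` X = \<phi> -` (snd c ` X)" for X
  proof (intro set_eqI iffI)
    fix z assume "z \<in> \<phi> -` (snd c ` X)"
    then obtain q where "q \<in> X" "\<phi> z = snd c q" by blast
    moreover from this have "z = (\<psi> \<circ> snd c) q" using inv(2)[of z] by simp
    ultimately show "z \<in> (\<psi> \<circ> snd c) ` X" by blast
  qed (auto simp: inv)
  have open_\<phi>: "open (\<phi> -` Y)" if "open Y" for Y
    using that cont(2) by (intro open_vimage) auto
  have chart: "is_chart ?d"
    unfolding is_chart_def fst_conv snd_conv
  proof (intro conjI)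
    show "open (fst c)" by (rule open_dom[OF c])
    show "open ((\<psi> \<circ> snd c) ` fst c)"
      unfolding img by (rule open_\<phi>[OF open_img[OF c]])
    show "homeomorphism (fst c) ((\<psi> \<circ> snd c) ` fst c) (\<psi> \<circ> snd c) (chart_inv ?d)"
    proof (rule homeomorphismI)
      show "continuous_on (fst c) (\<psi> \<circ> snd c)"
        by (intro continuous_on_compose continuous_on_chart c cont)
      have "continuous_on ((\<psi> \<circ> snd c) ` fst c) (chart_inv c \<circ> \<phi>)"
        unfolding img
        by (rule continuous_on_compose[OF cont(2)],
            rule continuous_on_subset[OF continuous_on_chart_inv[OF c]]) auto
      then show "continuous_on ((\<psi> \<circ> snd c) ` fst c) (chart_inv ?d)"
        by (rule continuous_on_eq) (simp add: dinv)
      show "chart_inv ?d ` (\<psi> \<circ> snd c) ` fst c \<subseteq> fst c"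
        using dinv c inv(1) by auto
      show "chart_inv ?d ((\<psi> \<circ> snd c) x) = x" if "x \<in> fst c" for x
        using dinv[of "(\<psi> \<circ> snd c) x"] that c inv(1) by auto
      show "(\<psi> \<circ> snd c) (chart_inv ?d y) = y" if "y \<in> (\<psi> \<circ> snd c) ` fst c" for y
        using dinv[OF that] that c inv(1) by auto
    qed simp
  qed
  moreover have "smooth_compatible ?d e" if e: "e \<in> A" for e
    unfolding smooth_compatible_def fst_conv snd_conv
  proof
    let ?S = "snd c ` (fst c \<inter> fst e)"
    have S: "open ?S" by (rule open_img_Int[OF c open_dom[OF e]])
    have "smooth_on (transition c e \<circ> \<phi>) (\<phi> -` ?S)"
      by (rule smooth_on_compose[OF open_\<phi>[OF S] S smooth_on_transition[OF c e]])
         (auto intro: smooth_on_subset[OF \<phi>])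
    moreover have "(snd e \<circ> chart_inv ?d) z = (transition c e \<circ> \<phi>) z" if "z \<in> \<phi> -` ?S" for z
    proof -
      have "z \<in> (\<psi> \<circ> snd c) ` fst c" using that unfolding img by blast
      then show ?thesis using dinv by (simp add: transition_def)
    qed
    ultimately show "smooth_on (snd e \<circ> chart_inv ?d) ((\<psi> \<circ> snd c) ` (fst c \<inter> fst e))"
      unfolding img by (subst smooth_on_cong[OF open_\<phi>[OF S]])
    have "smooth_on (\<psi> \<circ> transition e c) (snd e ` (fst e \<inter> fst c))"
      by (rule smooth_on_compose[OF open_img_Int[OF e open_dom[OF c]] open_UNIV \<psi>
            smooth_on_transition[OF e c]]) simp
    then show "smooth_on ((\<psi> \<circ> snd c) \<circ> chart_inv e) (snd e ` (fst c \<inter> fst e))"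
      by (simp add: transition_def o_assoc Int_commute)
  qed
  ultimately show ?thesis
    using smooth_struct unfolding smooth_structure_def by blast
qed

text \<open>In the chosen chart at \<open>p\<close>, with \<open>x\<^sub>0\<close> the coordinates of \<open>p\<close>, the submanifold consists of the
  points \<open>x\<^sub>0 + z + Q z z / 2 * m\<close> of the chart with \<open>z \<in> E\<close>. The condition that \<open>m\<close> is in the
  radical of \<open>Q\<close> makes the shear invertible by changing the sign of \<open>Q\<close>. The last conclusion says that
  the second fundamental form, computed in the flat coordinates and modulo \<open>E\<close>, is \<open>Q * m\<close>; it holds
  for every tangent extension \<open>V\<close> of \<open>v\<close>.\<close>

lemma ex_submanifold_second_fundamental_form:
  fixes p :: 'm and E :: "'e set" and Q :: "'e \<Rightarrow> 'e \<Rightarrow> real"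
  assumes E: "subspace E" and Q: "bilinear Q" and Q_sym: "\<And>u v. Q u v = Q v u"
    and Q_m: "\<And>u. Q u m = 0"
  obtains P where "submanifold A P" "p \<in> P" "tangent_space A P p = E"
    "\<And>v. v \<in> E \<Longrightarrow> \<exists>V. tangent_extension A P p v V"
    "\<And>u v V. u \<in> E \<Longrightarrow> tangent_extension A P p v V \<Longrightarrow>
        frechet_derivative (field_coord A (chart_at A p) V) (at (snd (chart_at A p) p)) u
          - Q u v *\<^sub>R m \<in> E"
proof -
  define c where "c = chart_at A p"
  have c: "c \<in> A" "p \<in> fst c" using chart_at by (auto simp: c_def)
  define x0 where "x0 = snd c p"
  have bQ: "bounded_bilinear Q" using Q bilinear_conv_bounded_bilinear by blast
  note Qs = bilinear_ladd[OF Q] bilinear_radd[OF Q] bilinear_lsub[OF Q] bilinear_rsub[OF Q]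
    bilinear_lmul[OF Q] bilinear_rmul[OF Q] bilinear_lzero[OF Q] bilinear_rzero[OF Q]
  have m_Q: "Q m u = 0" for u using Q_m[of u] Q_sym[of m u] by simp
  define \<phi> where "\<phi> z = x0 + (z + Q z z *\<^sub>R (m /\<^sub>R 2))" for z
  define \<psi> where "\<psi> x = (x - x0) + Q (x - x0) (x - x0) *\<^sub>R (- m /\<^sub>R 2)" for x
  have inv: "\<phi> (\<psi> x) = x" "\<psi> (\<phi> z) = z" for x z
    by (simp_all add: \<phi>_def \<psi>_def Qs Q_m m_Q bilinear_lneg[OF Q] bilinear_rneg[OF Q])
  have sm_aff: "smooth_on (\<lambda>x::'e. e + x) UNIV" for e
    by (rule smooth_on_affine[of UNIV "\<lambda>x. x"]) auto
  have sm\<phi>: "smooth_on \<phi> UNIV"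
  proof -
    have "smooth_on (\<lambda>z. (x0 + z) + Q z z *\<^sub>R (m /\<^sub>R 2)) UNIV"
      by (intro smooth_on_add sm_aff smooth_on_quadratic Q) auto
    then show ?thesis by (simp add: \<phi>_def[abs_def] add.assoc)
  qed
  have sm\<psi>: "smooth_on \<psi> UNIV"
  proof -
    have "smooth_on (\<lambda>y. (0 + y) + Q y y *\<^sub>R (- m /\<^sub>R 2)) UNIV"
      by (intro smooth_on_add sm_aff smooth_on_quadratic Q) auto
    then have "smooth_on ((\<lambda>y. (0 + y) + Q y y *\<^sub>R (- m /\<^sub>R 2)) \<circ> (\<lambda>x. - x0 + x)) UNIV"
      by (intro smooth_on_compose[of UNIV UNIV] sm_aff) auto
    moreover have "((\<lambda>y. (0 + y) + Q y y *\<^sub>R (- m /\<^sub>R 2)) \<circ> (\<lambda>x. - x0 + x)) = \<psi>"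
      by (rule ext) (simp add: \<psi>_def)
    ultimately show ?thesis by simp
  qed
  define d where "d = (fst c, \<psi> \<circ> snd c)"
  have dA: "d \<in> A" unfolding d_def by (rule diffeomorphic_chart[OF c(1) sm\<psi> sm\<phi> inv])
  have d: "fst d = fst c" "\<And>q. snd d q = \<psi> (snd c q)" by (simp_all add: d_def)
  define P where "P = {q \<in> fst c. snd d q \<in> E}"
  have slice: "snd d ` (fst d \<inter> P) = snd d ` fst d \<inter> E" by (auto simp: P_def d(1))
  have dp: "snd d p = 0" by (simp add: d(2) \<psi>_def x0_def Qs)
  have pP: "p \<in> P" using c(2) dp E by (simp add: P_def subspace_0)
  have tr_dc: "dtransition d c q = (\<lambda>v. v + Q (snd d q) v *\<^sub>R m)" if q: "q \<in> fst c" for q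
  proof (rule dtransition_eqI[where f = \<phi> and U = UNIV])
    have "((\<lambda>z. x0 + (z + Q z z *\<^sub>R (m /\<^sub>R 2))) has_derivative
        (\<lambda>v. 0 + (v + (Q (snd d q) v + Q v (snd d q)) *\<^sub>R (m /\<^sub>R 2)))) (at (snd d q))"
      by (intro has_derivative_add has_derivative_const has_derivative_ident
          has_derivative_scaleR_left bounded_bilinear.FDERIV[OF bQ])
    then show "(\<phi> has_derivative (\<lambda>v. v + Q (snd d q) v *\<^sub>R m)) (at (snd d q))"
      by (simp add: \<phi>_def[abs_def] Q_sym[of _ "snd d q"])
    show "\<phi> x = transition d c x" if x: "x \<in> snd d ` fst d" for x
    proof -
      obtain r where "r \<in> fst d" "x = snd d r" using x by blast
      then show ?thesis using transition_chart[OF dA, of r c] inv(1) by (simp add: d(2))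
    qed
  qed (use c dA q d in auto)
  have tr_cd: "dtransition c d q = (\<lambda>v. v - Q (snd c q - x0) v *\<^sub>R m)" if q: "q \<in> fst c" for q
  proof (rule dtransition_eqI[where f = \<psi> and U = UNIV])
    let ?y = "snd c q - x0"
    have "((\<lambda>x. (x - x0) + Q (x - x0) (x - x0) *\<^sub>R (- m /\<^sub>R 2)) has_derivative
        (\<lambda>v. (v - 0) + (Q ?y (v - 0) + Q (v - 0) ?y) *\<^sub>R (- m /\<^sub>R 2))) (at (snd c q))"
      by (intro has_derivative_add has_derivative_diff has_derivative_const has_derivative_ident
          has_derivative_scaleR_left bounded_bilinear.FDERIV[OF bQ])
    then show "(\<psi> has_derivative (\<lambda>v. v - Q ?y v *\<^sub>R m)) (at (snd c q))"
      by (simp add: \<psi>_def[abs_def] Q_sym[of _ ?y])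
    show "\<psi> x = transition c d x" if x: "x \<in> snd c ` fst c" for x
      using x transition_chart[OF c(1), of _ d] by (auto simp: d(2))
  qed (use c dA q d in auto)
  have from_p: "from_coord A d p v = v" for v
    using tr_dc[OF c(2)] by (simp add: from_coord_eq flip: c_def) (simp add: dp Qs)
  have TP: "tangent_space A P q = from_coord A d q ` E" if "q \<in> P" for q
    by (rule tangent_space_slice[OF dA E slice that]) (use that in \<open>simp add: P_def d(1)\<close>)
  show thesis
  proof (rule that)
    show "submanifold A P"
      unfolding submanifold_def
    proof (intro exI[of _ "dim E"] ballI bexI[of _ d] conjI exI[of _ E])
      show "q \<in> fst d" if "q \<in> P" for q using that by (simp add: P_def d(1))
    qed (use E slice dA in simp_all)
    show "p \<in> P" by (rule pP)
    show "tangent_space A P p = E" using TP[OF pP] from_p by simp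
    show "\<exists>V. tangent_extension A P p v V" if "v \<in> E" for v
      using tangent_extension_coordinate_field[OF dA E slice _ that, of p] c(2) d(1) from_p by auto
  next
    fix u v V assume u: "u \<in> E" and ext: "tangent_extension A P p v V"
    obtain W where W: "open W" "p \<in> W" "smooth_field_on A V W"
      "\<And>q. q \<in> P \<Longrightarrow> q \<in> W \<Longrightarrow> V q \<in> tangent_space A P q" and Vp: "V p = v"
      using ext unfolding tangent_extension_def by blast
    let ?X = "field_coord A c V"
    let ?D = "frechet_derivative ?X (at x0)"
    have "smooth_on ?X (snd c ` (fst c \<inter> W))"
      using W(3) c(1) unfolding smooth_field_on_def by blast
    then have DX: "(?X has_derivative ?D) (at x0)"
      using smooth_on_has_derivative W(2) c(2) unfolding x0_def by blast
    have Xx0: "?X x0 = v"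
      using Vp c dtransition_refl[OF c, of v] unfolding field_coord_def x0_def to_coord_eq
      by (simp flip: c_def)
    let ?\<xi> = "\<lambda>t. \<phi> (t *\<^sub>R u)"
    have \<xi>: "?\<xi> t - x0 = t *\<^sub>R u + (t * t * Q u u / 2) *\<^sub>R m" for t
      by (simp add: \<phi>_def Qs)
    \<comment> \<open>\<open>?F t\<close> is the value of the field at the point \<open>?\<xi> t\<close> of the submanifold in the slice chart
      \<open>d\<close>. It lies in \<open>E\<close> for small \<open>t\<close>, and so does its derivative at \<open>0\<close>.\<close>
    let ?F = "\<lambda>t. ?X (?\<xi> t) - (t * Q u (?X (?\<xi> t))) *\<^sub>R m"
    have D\<xi>: "(?\<xi> has_vector_derivative u) (at 0)"
    proof -
      have "((\<lambda>t. x0 + t *\<^sub>R u + (t * t * Q u u / 2) *\<^sub>R m) has_vector_derivative u) (at 0)"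
        by (auto intro!: derivative_eq_intros)
      moreover have "?\<xi> = (\<lambda>t. x0 + t *\<^sub>R u + (t * t * Q u u / 2) *\<^sub>R m)"
        using \<xi> by (auto simp: algebra_simps)
      ultimately show ?thesis by simp
    qed
    have \<phi>0: "\<phi> 0 = x0" by (simp add: \<phi>_def Qs)
    then have \<xi>0: "?\<xi> 0 = x0" by simp
    have DX\<xi>: "((\<lambda>t. ?X (?\<xi> t)) has_vector_derivative ?D u) (at 0)"
    proof -
      have "((?X \<circ> ?\<xi>) has_derivative (?D \<circ> (\<lambda>t. t *\<^sub>R u))) (at 0)"
        using D\<xi> DX unfolding has_vector_derivative_def
        by (intro diff_chain_at) (simp_all add: \<phi>0)
      moreover have "?D \<circ> (\<lambda>t. t *\<^sub>R u) = (\<lambda>t. t *\<^sub>R ?D u)"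
        using linear_scale[OF has_derivative_linear[OF DX]] by (simp add: o_def)
      ultimately show ?thesis by (simp add: has_vector_derivative_def o_def)
    qed
    have "bounded_linear (Q u)" using bQ bounded_bilinear.bounded_linear_right by blast
    then have "((\<lambda>t. Q u (?X (?\<xi> t))) has_vector_derivative Q u (?D u)) (at 0)"
      using DX\<xi> bounded_linear.has_vector_derivative by blast
    then have DQ: "((\<lambda>t. Q u (?X (?\<xi> t))) has_real_derivative Q u (?D u)) (at 0)"
      by (simp add: has_real_derivative_iff_has_vector_derivative)
    have "((\<lambda>t. t * Q u (?X (?\<xi> t))) has_real_derivative Q u v) (at 0)"
      using DERIV_mult[OF DERIV_ident DQ] by (simp add: \<phi>0 Xx0)
    then have DF: "(?F has_vector_derivative ?D u - Q u v *\<^sub>R m) (at 0)"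
      by (intro has_vector_derivative_diff DX\<xi>
          bounded_linear.has_vector_derivative[OF bounded_linear_scaleR_left])
        (simp add: has_real_derivative_iff_has_vector_derivative)
    have cont: "isCont ?\<xi> 0"
      using D\<xi> has_vector_derivative_continuous by blast
    have S: "open (snd c ` (fst c \<inter> W))" by (rule open_img_Int[OF c(1) W(1)])
    have "?\<xi> 0 \<in> snd c ` (fst c \<inter> W)" unfolding \<xi>0 x0_def using c(2) W(2) by blast
    then obtain e where e: "e > 0" "ball (?\<xi> 0) e \<subseteq> snd c ` (fst c \<inter> W)"
      using S open_contains_ball by blast
    obtain \<delta> where \<delta>: "\<delta> > 0"
      "\<And>t. dist t 0 < \<delta> \<Longrightarrow> ?\<xi> t \<in> snd c ` (fst c \<inter> W)"
    proof -
      obtain \<delta> where "\<delta> > 0" "\<forall>t. dist t 0 < \<delta> \<longrightarrow> dist (?\<xi> t) (?\<xi> 0) < e"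
        using cont e(1) unfolding continuous_at_eps_delta by blast
      then show thesis using e(2) by (intro that[of \<delta>]) (auto simp: dist_commute)
    qed
    have FE: "?F t \<in> E" if "dist t 0 < \<delta>" for t
    proof -
      obtain q where q: "q \<in> fst c" "q \<in> W" "?\<xi> t = snd c q" using \<delta>(2)[OF \<open>dist t 0 < \<delta>\<close>] by blast
      have "snd d q = t *\<^sub>R u" using inv(2)[of "t *\<^sub>R u"] q(3) by (simp add: d(2))
      then have qP: "q \<in> P" using q(1) u E by (simp add: P_def subspace_scale)
      then obtain e where e: "e \<in> E" "V q = from_coord A d q e" using W(4)[OF _ q(2)] TP by blast
      have "?X (?\<xi> t) = dtransition d c q e"
        unfolding q(3) using e(2) q(1) c dA d(1) chart_at
        by (simp add: field_coord_def to_coord_eq from_coord_eq dtransition_compose)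
      then have "dtransition c d q (?X (?\<xi> t)) = e"
        using dtransition_inverse[OF dA c(1), of q e] q(1) d(1) by simp
      moreover have "dtransition c d q (?X (?\<xi> t)) = ?F t"
        unfolding tr_cd[OF q(1)] q(3)[symmetric] \<xi> by (simp add: Qs m_Q)
      ultimately show ?thesis using e(1) by simp
    qed
    have "?D u - Q u v *\<^sub>R m \<in> E"
      by (rule has_vector_derivative_in_subspace[OF DF _ _ \<delta>(1) FE E]) auto
    then show "frechet_derivative (field_coord A (chart_at A p) V) (at (snd (chart_at A p) p)) u
        - Q u v *\<^sub>R m \<in> E"
      unfolding x0_def c_def .
  qed
qed

end

section \<open>Submanifolds that realise Lagrangian subspaces\<close>

context semi_riemannian_manifold
begin

text \<open>The geometric statement for an arbitrary nonzero vector \<open>n\<close> orthogonal to \<open>fst ` L\<close>. For the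
  submanifold constructed here, the shape operator at \<open>p\<close> is \<open>- \<pi> \<circ> \<omega>\<close>.\<close>

lemma ex_submanifold_lagrangian:
  fixes p :: 'm and n :: 'e
  assumes L: "lagrangian (g p) L" and nondeg: "nondegenerate_on (g p) (fst ` L)"
    and n: "n \<in> g_perp (g p) (fst ` L)" "n \<noteq> 0"
  shows "\<exists>P. submanifold A P \<and> p \<in> P \<and> tangent_space A P p = fst ` L \<and>
    L = submanifold_lagrangian A g P p n"
proof -
  let ?c = "chart_at A p" and ?E = "fst ` L"
  let ?\<Gamma> = "christoffel A g ?c (snd ?c p)"
  note B = metric_bilinear[of p] and sym = metric_sym[of p]
  have x0: "?c \<in> A" "snd ?c p \<in> snd ?c ` fst ?c" using chart_at by auto
  note \<Gamma>_bil = christoffel_bilinear[OF x0] and \<Gamma>_sym = christoffel_sym[OF x0]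
  have E: "subspace ?E"
    using L linear_subspace_image[OF linear_fst] by (auto simp: lagrangian_def)
  obtain \<pi> where \<pi>: "linear \<pi>" "\<And>y. \<pi> y \<in> ?E" "\<And>v. v \<in> ?E \<Longrightarrow> \<pi> v = v"
    "\<And>y. y - \<pi> y \<in> g_perp (g p) ?E" "\<And>y. y \<in> g_perp (g p) ?E \<Longrightarrow> \<pi> y = 0"
    by (rule g_orthogonal_projection[OF B sym E nondeg]) blast
  obtain \<omega> where \<omega>: "linear \<omega>"
    "\<And>v v'. v \<in> ?E \<Longrightarrow> v' \<in> ?E \<Longrightarrow> g p (\<omega> v) v' = g p (\<omega> v') v"
    "L = {(v, w). v \<in> ?E \<and> w - \<omega> v \<in> g_perp (g p) ?E}"
    by (rule lagrangian_graph[OF B sym L nondeg]) blast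
  have gn: "g p e n = 0" if "e \<in> ?E" for e using n(1) that unfolding g_perp_def by blast
  \<comment> \<open>A vector that pairs nontrivially with \<open>n\<close> still does so after its component in \<open>E\<close> is removed.\<close>
  obtain m where m: "\<pi> m = 0" "g p m n = 1"
  proof -
    obtain y where y: "g p n y \<noteq> 0"
      using metric_nondegenerate[of p] n(2) unfolding nondegenerate_on_def by blast
    define m where "m = (1 / g p y n) *\<^sub>R (y - \<pi> y)"
    have "\<pi> m = 0"
      unfolding m_def using \<pi>(5)[OF \<pi>(4)[of y]] linear_scale[OF \<pi>(1)] by simp
    moreover have "g p m n = 1"
      using y gn[OF \<pi>(2)[of y]] sym[of n y] by (simp add: m_def bilinear_lmul[OF B] bilinear_lsub[OF B])
    ultimately show thesis by (rule that)
  qed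
  \<comment> \<open>The prescribed second fundamental form minus the contribution of the Christoffel symbols.\<close>
  define Q where "Q u v = - g p (\<omega> (\<pi> u)) (\<pi> v) - g p (?\<Gamma> (\<pi> u) (\<pi> v)) n" for u v
  have Q_bil: "bilinear Q"
    unfolding bilinear_def Q_def
    by (auto intro!: linearI simp: linear_add[OF \<pi>(1)] linear_scale[OF \<pi>(1)]
        linear_add[OF \<omega>(1)] linear_scale[OF \<omega>(1)]
        bilinear_ladd[OF B] bilinear_radd[OF B] bilinear_lmul[OF B] bilinear_rmul[OF B]
        bilinear_ladd[OF \<Gamma>_bil] bilinear_radd[OF \<Gamma>_bil] bilinear_lmul[OF \<Gamma>_bil]
        bilinear_rmul[OF \<Gamma>_bil] algebra_simps)
  have Q_sym: "Q u v = Q v u" for u v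
    using \<omega>(2)[OF \<pi>(2)[of u] \<pi>(2)[of v]] \<Gamma>_sym[of "\<pi> u" "\<pi> v"] by (simp add: Q_def)
  have Q_m: "Q u m = 0" for u
    by (simp add: Q_def m(1) bilinear_rzero[OF B] bilinear_rzero[OF \<Gamma>_bil] bilinear_lzero[OF B])
  obtain P where P: "submanifold A P" "p \<in> P" "tangent_space A P p = ?E"
    "\<And>v. v \<in> ?E \<Longrightarrow> \<exists>V. tangent_extension A P p v V"
    "\<And>u v V. u \<in> ?E \<Longrightarrow> tangent_extension A P p v V \<Longrightarrow>
        frechet_derivative (field_coord A ?c V) (at (snd ?c p)) u - Q u v *\<^sub>R m \<in> ?E"
    by (rule ex_submanifold_second_fundamental_form[OF E Q_bil Q_sym Q_m, of p]) blast
  have sff: "g p (nabla A g V p u) n = - g p (\<omega> u) v"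
    if u: "u \<in> ?E" and v: "v \<in> ?E" and ext: "tangent_extension A P p v V" for u v V
  proof -
    let ?D = "frechet_derivative (field_coord A ?c V) (at (snd ?c p)) u"
    have "V p = v" using ext by (simp add: tangent_extension_def)
    then have "nabla A g V p u = ?D + ?\<Gamma> u v" by (simp add: nabla_def Let_def)
    moreover have "g p ?D n = Q u v"
      using gn[OF P(5)[OF u ext]] m(2) by (simp add: bilinear_lsub[OF B] bilinear_lmul[OF B])
    ultimately show ?thesis
      by (simp add: bilinear_ladd[OF B] Q_def \<pi>(3)[OF u] \<pi>(3)[OF v])
  qed
  have shape: "shape_operator A g P p n v = - \<pi> (\<omega> v)" if v: "v \<in> ?E" for v
    unfolding shape_operator_def P(3)
  proof (rule the_equality)
    have \<pi>\<omega>: "g p (\<pi> (\<omega> v)) v' = g p (\<omega> v) v'" if "v' \<in> ?E" for v'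
      proof -
      have "g p v' (\<omega> v - \<pi> (\<omega> v)) = 0"
        using \<pi>(4)[of "\<omega> v"] that unfolding g_perp_def by blast
      then show ?thesis
        using sym[of v' "\<omega> v"] sym[of v' "\<pi> (\<omega> v)"] by (simp add: bilinear_rsub[OF B])
    qed
    have neg: "- \<pi> (\<omega> v) \<in> ?E" using \<pi>(2) subspace_neg[OF E] by blast
    have char: "g p (- \<pi> (\<omega> v)) v' = - g p (\<omega> v) v'" if "v' \<in> ?E" for v'
      using \<pi>\<omega>[OF that] by (simp add: bilinear_lneg[OF B])
    show "- \<pi> (\<omega> v) \<in> ?E \<and> (\<forall>v'\<in>?E. \<forall>V'. tangent_extension A P p v' V' \<longrightarrow>
        g p (- \<pi> (\<omega> v)) v' = g p (nabla A g V' p v) n)"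
      using neg char sff[OF v] by simp
    fix s assume s: "s \<in> ?E \<and> (\<forall>v'\<in>?E. \<forall>V'. tangent_extension A P p v' V' \<longrightarrow>
        g p s v' = g p (nabla A g V' p v) n)"
    have "g p (s - - \<pi> (\<omega> v)) v' = 0" if v': "v' \<in> ?E" for v'
    proof -
      obtain V' where V': "tangent_extension A P p v' V'" using P(4)[OF v'] by blast
      then have "g p s v' = - g p (\<omega> v) v'" using s v' sff[OF v v' V'] by metis
      then show ?thesis using char[OF v'] by (simp only: bilinear_lsub[OF B])
    qed
    moreover have "s - - \<pi> (\<omega> v) \<in> ?E" using s neg subspace_diff[OF E] by blast
    ultimately have "s - - \<pi> (\<omega> v) = 0" using nondeg unfolding nondegenerate_on_def by blast
    then show "s = - \<pi> (\<omega> v)" by (simp only: right_minus_eq)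
  qed
  \<comment> \<open>\<open>\<omega> v\<close> and its projection to \<open>E\<close> differ by a vector orthogonal to \<open>E\<close>.\<close>
  have perp: "w + - \<pi> (\<omega> v) \<in> g_perp (g p) ?E \<longleftrightarrow> w - \<omega> v \<in> g_perp (g p) ?E" for v w
  proof -
    have "w + - \<pi> (\<omega> v) = (w - \<omega> v) + (\<omega> v - \<pi> (\<omega> v))"
      "w - \<omega> v = (w + - \<pi> (\<omega> v)) - (\<omega> v - \<pi> (\<omega> v))" by simp_all
    then show ?thesis
      using \<pi>(4)[of "\<omega> v"] subspace_add[OF subspace_g_perp[OF B]]
        subspace_diff[OF subspace_g_perp[OF B]] by metis
  qed
  have "v \<in> ?E \<and> w + shape_operator A g P p n v \<in> g_perp (g p) ?E \<longleftrightarrow>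
      v \<in> ?E \<and> w - \<omega> v \<in> g_perp (g p) ?E" for v w
    using shape[of v] perp[of w v] by metis
  then have "submanifold_lagrangian A g P p n = {(v, w). v \<in> ?E \<and> w - \<omega> v \<in> g_perp (g p) ?E}"
    unfolding submanifold_lagrangian_def P(3) by (simp only:)
  then show ?thesis using P(1-3) \<omega>(3) by metis
qed

end

theorem lemma4p1:
  fixes A :: "('m::{t2_space, second_countable_topology}, 'e::euclidean_space) chart set"
    and g :: "'m \<Rightarrow> 'e \<Rightarrow> 'e \<Rightarrow> real"
    and \<gamma> :: "real \<Rightarrow> 'm"
    and a b :: real
    and L :: "('e \<times> 'e) set"
  assumes "smooth_structure A"
    and "semi_riemannian_metric A g"
    and "a < b"
    and "geodesic A g \<gamma> a b"
    and "\<exists>s\<in>{a..b}. \<exists>t\<in>{a..b}. \<gamma> s \<noteq> \<gamma> t"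
    and "lagrangian (g (\<gamma> a)) L"
    and "velocity A \<gamma> {a..b} a \<in> g_perp (g (\<gamma> a)) (fst ` L)"
    and "nondegenerate_on (g (\<gamma> a)) (fst ` L)"
  shows "\<exists>P. submanifold A P \<and> \<gamma> a \<in> P \<and>
    velocity A \<gamma> {a..b} a \<in> g_perp (g (\<gamma> a)) (tangent_space A P (\<gamma> a)) \<and>
    nondegenerate_on (g (\<gamma> a)) (tangent_space A P (\<gamma> a)) \<and>
    L = submanifold_lagrangian A g P (\<gamma> a) (velocity A \<gamma> {a..b} a)"
proof -
  interpret semi_riemannian_manifold A g
    by unfold_locales (use assms in auto)
  have "velocity A \<gamma> {a..b} a \<noteq> 0"
    using nonconstant_geodesic_velocity_nonzero[OF assms(4,3)] assms(3,5) by auto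
  from ex_submanifold_lagrangian[OF assms(6,8,7) this] obtain P where
    "submanifold A P" "\<gamma> a \<in> P" "tangent_space A P (\<gamma> a) = fst ` L"
    "L = submanifold_lagrangian A g P (\<gamma> a) (velocity A \<gamma> {a..b} a)"
    by blast
  then show ?thesis using assms(7,8) by metis
qed

end
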